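(* For every infinite cardinal $\kappa\le\mathfrak{c}$ there exist $2^\kappa$ pairwise non-homeomorphic topologies $\tau\in\mathcal{L}$ such that $(\mathbb{R},\tau)$ is a completely normal space of first category of weight $\kappa$.
   Context: $\mathfrak{c}=|\mathbb{R}|$. $\eta$ denotes the Euclidean topology on $\mathbb{R}$. $\mathcal{L}$ denotes the family of all Hausdorff topologies $\tau$ on $\mathbb{R}$ with $\tau\subset\eta$. The weight of a space is the least cardinality of a base of its topology. *)

theory Defs
  imports "HOL-Analysis.Analysis" "HOL-Library.Equipollence"
begin

definition is_base_of :: "'a set set \<Rightarrow> 'a topology \<Rightarrow> bool" where
  "is_base_of B X \<longleftrightarrow> (\<forall>U\<in>B. openin X U) \<and>
     (\<forall>U. openin X U \<longrightarrow> (\<exists>C. C \<subseteq> B \<and> \<Union>C = U))"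

definition has_weight :: "'a topology \<Rightarrow> 'b set \<Rightarrow> bool" where
  "has_weight X K \<longleftrightarrow> (\<exists>B. is_base_of B X \<and> B \<approx> K) \<and>
     (\<forall>B. is_base_of B X \<longrightarrow> K \<lesssim> B)"

definition nowhere_dense_in :: "'a topology \<Rightarrow> 'a set \<Rightarrow> bool" where
  "nowhere_dense_in X A \<longleftrightarrow> A \<subseteq> topspace X \<and> X interior_of (X closure_of A) = {}"

definition first_category :: "'a topology \<Rightarrow> bool" where
  "first_category X \<longleftrightarrow>
     (\<exists>N :: nat \<Rightarrow> 'a set. (\<forall>n. nowhere_dense_in X (N n)) \<and> topspace X = (\<Union>n. N n))"

text \<open>Completely normal = hereditarily normal (plus T1, implied by Hausdorff here).\<close>
definition completely_normal_space :: "'a topology \<Rightarrow> bool" where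
  "completely_normal_space X \<longleftrightarrow> t1_space X \<and> hereditarily normal_space X"

definition L_family :: "real topology set" where
  "L_family = {\<tau>. topspace \<tau> = UNIV \<and> Hausdorff_space \<tau> \<and>
                  (\<forall>U. openin \<tau> U \<longrightarrow> open U)}"

end

theory Submission
  imports Defs
begin

text \<open>
  Wind the line densely around a torus by \<open>t \<mapsto> (cis t, cis (sqrt 2 * t))\<close> and pull back the topology. Every
  nonempty open set is unbounded, so the compact intervals are nowhere dense; and the Euclidean line
  being hereditarily Lindelof, any coarser regular Hausdorff topology is completely normal. Points \<open>c k\<close> running off to
  infinity converge to \<open>0\<close> in this topology. Let \<open>bumpsum X\<close> be the sum of bumps of rapidly
  shrinking supports around the \<open>c k\<close> with \<open>k \<in> X\<close>. It is continuous except at \<open>0\<close>, and making it (or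
  a translate) continuous refines the topology at one point only. Doing so at \<open>- 1\<close> for an almost
  disjoint family of \<open>\<kappa>\<close> sets \<open>X\<close> produces local character, hence weight, exactly \<open>\<kappa>\<close>.

  A homeomorphism between two such topologies is a homeomorphism of the Euclidean line, since a
  path in the winding line lifts to the plane. So it is determined by its restriction to the
  rationals, and there are at most \<open>2\<^sup>\<omega>\<close> homeomorphic copies of each topology. If \<open>2\<^sup>\<kappa> > 2\<^sup>\<omega>\<close>, then
  choosing one topology from each homeomorphism class suffices. Otherwise, bumps are added at
  countably many further points: these are exactly the points where neighbouring strands of the
  line cannot be followed, and their order pattern on the line codes an arbitrary set of natural
  numbers that the homeomorphism type remembers.
\<close>

section \<open>Cardinal arithmetic\<close>

lemma times_self_lepoll: "infinite A \<Longrightarrow> A \<times> A \<lesssim> A"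
  using card_of_Times_same_infinite[of A] eqpoll_iff_card_of_ordIso eqpoll_imp_lepoll by blast

lemma times_lepoll_infinite: "infinite C \<Longrightarrow> A \<lesssim> C \<Longrightarrow> B \<lesssim> C \<Longrightarrow> A \<times> B \<lesssim> C"
  by (rule lepoll_trans[OF times_lepoll_mono times_self_lepoll])

lemma nat_lepoll_infinite: "infinite A \<Longrightarrow> countable B \<Longrightarrow> B \<lesssim> A"
  unfolding infinite_le_lepoll by (rule lepoll_trans[of B "UNIV :: nat set"]) (auto simp: countable_def lepoll_def)

lemma Un_lepoll_infinite:
  assumes "infinite C" "A \<lesssim> C" "B \<lesssim> C"
  shows "A \<union> B \<lesssim> C"
proof -
  obtain f where f: "inj_on f A" "f ` A \<subseteq> C" using assms(2) by (auto simp: lepoll_def)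
  obtain g where g: "inj_on g B" "g ` B \<subseteq> C" using assms(3) by (auto simp: lepoll_def)
  define h where "h x = (if x \<in> A then (f x, True) else (g x, False))" for x
  have "inj_on h (A \<union> B)" "h ` (A \<union> B) \<subseteq> C \<times> UNIV"
    using f g by (auto simp: h_def inj_on_def)
  then have "A \<union> B \<lesssim> C \<times> (UNIV :: bool set)" by (auto simp: lepoll_def)
  also have "\<dots> \<lesssim> C"
    by (simp add: assms(1) nat_lepoll_infinite times_lepoll_infinite)
  finally show ?thesis .
qed

text \<open>Every finite subset is the set of entries of some list. Lists of a fixed length inject
  into \<open>K\<close> by induction on the length, and a countable union of such sets is still
  dominated by \<open>K\<close>.\<close>

lemma Fpow_lepoll:
  assumes "infinite K" shows "Fpow K \<lesssim> K"
proof -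
  define L where "L n = {xs. set xs \<subseteq> K \<and> length xs = n}" for n
  have L: "L n \<lesssim> K" for n
  proof (induction n)
    case 0
    have "L 0 = {[]}" by (auto simp: L_def)
    then show ?case using nat_lepoll_infinite[OF assms, of "L 0"] by simp
  next
    case (Suc n)
    have "L (Suc n) = (\<lambda>(x, xs). x # xs) ` (K \<times> L n)"
      by (auto simp: L_def length_Suc_conv image_iff)
    then have "L (Suc n) \<lesssim> K \<times> L n" by (simp add: image_lepoll)
    also have "K \<times> L n \<lesssim> K" by (intro times_lepoll_infinite[OF assms] Suc.IH lepoll_refl)
    finally show ?case .
  qed
  have "Fpow K \<subseteq> set ` (\<Union>n. L n)"
    by (auto simp: Fpow_def L_def image_iff dest!: finite_list)
  then have "Fpow K \<lesssim> (\<Union>n. L n)" by (rule subset_image_lepoll)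
  also have "(\<Union>n. L n) \<lesssim> K"
    using nat_lepoll_infinite[OF assms, of "UNIV :: nat set"] L
      card_of_UNION_ordLeq_infinite[OF assms, of UNIV L]
    unfolding lepoll_def card_of_ordLeq by simp
  finally show ?thesis .
qed

lemma lepoll_total: "A \<lesssim> B \<or> B \<lesssim> A"
  unfolding lepoll_def card_of_ordLeq by (intro ordLeq_total card_of_Well_order)

text \<open>Numbering each finite fibre by natural numbers injects \<open>K\<close> into
  \<open>B \<times> UNIV\<close>, which \<open>B\<close> absorbs because it must be
  infinite.\<close>

lemma finite_to_one_lepoll:
  assumes "infinite K" "f ` K \<subseteq> B" "\<And>b. b \<in> B \<Longrightarrow> finite {i \<in> K. f i = b}"
  shows "K \<lesssim> B"
proof -
  have inf: "infinite B"
  proof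
    assume "finite B"
    then have "finite (\<Union>b\<in>B. {i \<in> K. f i = b})" using assms(3) by auto
    moreover have "K \<subseteq> (\<Union>b\<in>B. {i \<in> K. f i = b})" using assms(2) by auto
    ultimately show False using assms(1) finite_subset by blast
  qed
  have "\<exists>g :: 'a \<Rightarrow> nat. inj_on g {i \<in> K. f i = b}" if "b \<in> B" for b
    using assms(3)[OF that] countable_finite countable_def by blast
  then obtain g :: "'b \<Rightarrow> 'a \<Rightarrow> nat" where g: "\<And>b. b \<in> B \<Longrightarrow> inj_on (g b) {i \<in> K. f i = b}"
    by metis
  have "inj_on (\<lambda>i. (f i, g (f i) i)) K"
  proof (rule inj_onI)
    fix i j assume ij: "i \<in> K" "j \<in> K" "(f i, g (f i) i) = (f j, g (f j) j)"
    then have "f i \<in> B" "f j = f i" "g (f i) i = g (f i) j" using assms(2) by auto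
    then show "i = j" using g[of "f i"] ij by (auto simp: inj_on_def)
  qed
  moreover have "(\<lambda>i. (f i, g (f i) i)) ` K \<subseteq> B \<times> UNIV" using assms(2) by auto
  ultimately have "K \<lesssim> B \<times> (UNIV :: nat set)" by (auto simp: lepoll_def)
  also have "\<dots> \<lesssim> B" using inf by (simp add: nat_lepoll_infinite times_lepoll_infinite)
  finally show ?thesis .
qed

section \<open>Representatives of equivalence classes\<close>

lemma exists_transversal:
  assumes "equivp R"
  obtains F where "F \<subseteq> \<T>" "\<And>\<sigma> \<tau>. \<sigma> \<in> F \<Longrightarrow> \<tau> \<in> F \<Longrightarrow> R \<sigma> \<tau> \<Longrightarrow> \<sigma> = \<tau>"
    "\<And>\<tau>. \<tau> \<in> \<T> \<Longrightarrow> \<exists>\<sigma>\<in>F. R \<sigma> \<tau>"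
proof -
  \<comment> \<open>The predicate under \<open>SOME\<close> depends only on the class of
    \<open>\<tau>\<close>, so equivalent elements receive the very same representative.\<close>
  define c where "c \<tau> = (SOME \<sigma>. \<sigma> \<in> \<T> \<and> R \<sigma> \<tau>)" for \<tau>
  have c: "c \<tau> \<in> \<T> \<and> R (c \<tau>) \<tau>" if "\<tau> \<in> \<T>" for \<tau>
    unfolding c_def by (rule someI[of _ \<tau>]) (use that assms in \<open>simp add: equivp_reflp\<close>)
  have eq: "c \<sigma> = c \<tau>" if "R \<sigma> \<tau>" for \<sigma> \<tau>
  proof -
    have "R \<rho> \<sigma> \<longleftrightarrow> R \<rho> \<tau>" for \<rho> using that assms by (meson equivp_symp equivp_transp)
    then show ?thesis by (simp add: c_def)
  qed
  show ?thesis
  proof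
    show "c ` \<T> \<subseteq> \<T>" using c by auto
    show "\<exists>\<sigma>\<in>c ` \<T>. R \<sigma> \<tau>" if "\<tau> \<in> \<T>" for \<tau> using c that by blast
    fix \<sigma> \<tau> assume "\<sigma> \<in> c ` \<T>" "\<tau> \<in> c ` \<T>" and R: "R \<sigma> \<tau>"
    then obtain s t where s: "s \<in> \<T>" "\<sigma> = c s" and t: "t \<in> \<T>" "\<tau> = c t" by auto
    have "c \<sigma> = c s" "c \<tau> = c t" using c s t eq by auto
    then show "\<sigma> = \<tau>" using eq[OF R] s t by simp
  qed
qed

text \<open>An element is coded by its representative and its position in a class of size at most
  \<open>C\<close>, so \<open>\<T> \<lesssim> F \<times> C\<close>. As \<open>\<T>\<close> exceeds
  \<open>C\<close>, so does \<open>F\<close>, and the factor \<open>C\<close> is absorbed.\<close>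

lemma transversal_eqpoll:
  assumes eqv: "equivp R" and inf: "infinite C" and big: "\<not> \<T> \<lesssim> C"
    and small: "\<And>\<tau>. \<tau> \<in> \<T> \<Longrightarrow> {\<sigma> \<in> \<T>. R \<sigma> \<tau>} \<lesssim> C"
  obtains F where "F \<subseteq> \<T>" "F \<approx> \<T>" "\<And>\<sigma> \<tau>. \<sigma> \<in> F \<Longrightarrow> \<tau> \<in> F \<Longrightarrow> R \<sigma> \<tau> \<Longrightarrow> \<sigma> = \<tau>"
proof -
  obtain F where F: "F \<subseteq> \<T>" "\<And>\<sigma> \<tau>. \<sigma> \<in> F \<Longrightarrow> \<tau> \<in> F \<Longrightarrow> R \<sigma> \<tau> \<Longrightarrow> \<sigma> = \<tau>"
    "\<And>\<tau>. \<tau> \<in> \<T> \<Longrightarrow> \<exists>\<sigma>\<in>F. R \<sigma> \<tau>" using exists_transversal[OF eqv] by metis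
  have "\<exists>h. inj_on h {\<sigma> \<in> \<T>. R \<sigma> \<rho>} \<and> h ` {\<sigma> \<in> \<T>. R \<sigma> \<rho>} \<subseteq> C" if "\<rho> \<in> F" for \<rho>
    using small[of \<rho>] F(1) that by (auto simp: lepoll_def)
  then obtain h where h: "\<And>\<rho>. \<rho> \<in> F \<Longrightarrow> inj_on (h \<rho>) {\<sigma> \<in> \<T>. R \<sigma> \<rho>}"
    "\<And>\<rho>. \<rho> \<in> F \<Longrightarrow> h \<rho> ` {\<sigma> \<in> \<T>. R \<sigma> \<rho>} \<subseteq> C" by metis
  obtain c where c: "\<And>\<tau>. \<tau> \<in> \<T> \<Longrightarrow> c \<tau> \<in> F \<and> R \<tau> (c \<tau>)"
    using F(3) eqv by (metis equivp_symp)
  have "inj_on (\<lambda>\<tau>. (c \<tau>, h (c \<tau>) \<tau>)) \<T>"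
  proof (rule inj_onI)
    fix \<sigma> \<tau> assume *: "\<sigma> \<in> \<T>" "\<tau> \<in> \<T>" "(c \<sigma>, h (c \<sigma>) \<sigma>) = (c \<tau>, h (c \<tau>) \<tau>)"
    then have "h (c \<sigma>) \<sigma> = h (c \<sigma>) \<tau>" "R \<tau> (c \<sigma>)" "R \<sigma> (c \<sigma>)"
      using c[of \<sigma>] c[of \<tau>] by auto
    then show "\<sigma> = \<tau>" using inj_onD[OF h(1)[of "c \<sigma>"]] c * by blast
  qed
  moreover have "(\<lambda>\<tau>. (c \<tau>, h (c \<tau>) \<tau>)) ` \<T> \<subseteq> F \<times> C" using c h(2) by auto
  ultimately have le: "\<T> \<lesssim> F \<times> C" by (auto simp: lepoll_def)
  have "\<not> F \<lesssim> C"
    using big lepoll_trans[OF le times_lepoll_infinite[OF inf _ lepoll_refl]] by blast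
  then have CF: "C \<lesssim> F" using lepoll_total[of F C] by simp
  have "infinite F"
    using inf unfolding infinite_le_lepoll by (rule lepoll_trans[OF _ CF])
  then have "\<T> \<lesssim> F"
    by (rule lepoll_trans[OF le times_lepoll_infinite[OF _ lepoll_refl CF]])
  with subset_imp_lepoll[OF F(1)] have "F \<approx> \<T>" by (rule lepoll_antisym)
  from that[OF F(1) this F(2)] show ?thesis .
qed

section \<open>Initial topologies\<close>

text \<open>This is the coarsest topology that makes all of \<open>G\<close> continuous, described
  by its basic neighbourhoods so that openness can be tested point by point.\<close>

definition initial_topology :: "('a \<Rightarrow> 'b::metric_space) set \<Rightarrow> 'a topology" where
  "initial_topology G = topology (\<lambda>U. \<forall>x\<in>U. \<exists>e>0. \<exists>F. finite F \<and> F \<subseteq> G \<and>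
     {y. \<forall>f\<in>F. dist (f y) (f x) < e} \<subseteq> U)"

lemma openin_initial_topology:
  "openin (initial_topology G) U \<longleftrightarrow>
    (\<forall>x\<in>U. \<exists>e>0. \<exists>F. finite F \<and> F \<subseteq> G \<and> {y. \<forall>f\<in>F. dist (f y) (f x) < e} \<subseteq> U)"
proof -
  have "istopology (\<lambda>U. \<forall>x\<in>U. \<exists>e>0. \<exists>F. finite F \<and> F \<subseteq> G \<and>
     {y. \<forall>f\<in>F. dist (f y) (f x) < e} \<subseteq> U)"
    unfolding istopology_def
  proof (intro conjI allI impI ballI)
    fix S T x
    assume S: "\<forall>x\<in>S. \<exists>e>0. \<exists>F. finite F \<and> F \<subseteq> G \<and> {y. \<forall>f\<in>F. dist (f y) (f x) < e} \<subseteq> S"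
      and T: "\<forall>x\<in>T. \<exists>e>0. \<exists>F. finite F \<and> F \<subseteq> G \<and> {y. \<forall>f\<in>F. dist (f y) (f x) < e} \<subseteq> T"
      and x: "x \<in> S \<inter> T"
    obtain d D where D: "d > 0" "finite D" "D \<subseteq> G" "{y. \<forall>f\<in>D. dist (f y) (f x) < d} \<subseteq> S"
      using bspec[OF S, of x] x by auto
    obtain e E where E: "e > 0" "finite E" "E \<subseteq> G" "{y. \<forall>f\<in>E. dist (f y) (f x) < e} \<subseteq> T"
      using bspec[OF T, of x] x by auto
    have "{y. \<forall>f\<in>D \<union> E. dist (f y) (f x) < min d e} \<subseteq>
        {y. \<forall>f\<in>D. dist (f y) (f x) < d} \<inter> {y. \<forall>f\<in>E. dist (f y) (f x) < e}"
      by auto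
    then have "{y. \<forall>f\<in>D \<union> E. dist (f y) (f x) < min d e} \<subseteq> S \<inter> T"
      using D(4) E(4) by blast
    then show "\<exists>e>0. \<exists>F. finite F \<and> F \<subseteq> G \<and> {y. \<forall>f\<in>F. dist (f y) (f x) < e} \<subseteq> S \<inter> T"
      using D E by (intro exI[of _ "min d e"] exI[of _ "D \<union> E"] conjI) auto
  next
    fix \<K> x
    assume *: "\<forall>K\<in>\<K>. \<forall>x\<in>K. \<exists>e>0. \<exists>F. finite F \<and> F \<subseteq> G \<and>
        {y. \<forall>f\<in>F. dist (f y) (f x) < e} \<subseteq> K" and "x \<in> \<Union> \<K>"
    then obtain K where K: "K \<in> \<K>" "x \<in> K" by auto
    then obtain e F where "e > 0" "finite F" "F \<subseteq> G" "{y. \<forall>f\<in>F. dist (f y) (f x) < e} \<subseteq> K"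
      using bspec[OF bspec[OF * K(1)] K(2)] by auto
    then show "\<exists>e>0. \<exists>F. finite F \<and> F \<subseteq> G \<and> {y. \<forall>f\<in>F. dist (f y) (f x) < e} \<subseteq> \<Union> \<K>"
      using K(1) by (intro exI[of _ e] exI[of _ F] conjI) blast+
  qed
  then show ?thesis by (simp add: initial_topology_def)
qed

lemma openin_initial_topologyE:
  assumes "openin (initial_topology G) U" "x \<in> U"
  obtains e F where "e > 0" "finite F" "F \<subseteq> G" "{y. \<forall>f\<in>F. dist (f y) (f x) < e} \<subseteq> U"
  using bspec[OF assms(1)[unfolded openin_initial_topology] assms(2)] by auto

lemma topspace_initial_topology [simp]: "topspace (initial_topology G) = UNIV"
proof -
  have "openin (initial_topology G) UNIV"
    unfolding openin_initial_topology by (auto intro!: exI[of _ "1::real"])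
  then show ?thesis by (metis openin_subset top.extremum_uniqueI)
qed

lemma openin_initial_vimage:
  assumes "f \<in> G" "open S"
  shows "openin (initial_topology G) (f -` S)"
  unfolding openin_initial_topology
proof
  fix x assume "x \<in> f -` S"
  then obtain e where "e > 0" "ball (f x) e \<subseteq> S" using assms(2) openE by auto
  moreover from this have "{y. \<forall>h\<in>{f}. dist (h y) (h x) < e} \<subseteq> f -` S"
    by (auto simp: dist_commute subset_iff)
  ultimately show "\<exists>e>0. \<exists>F. finite F \<and> F \<subseteq> G \<and> {y. \<forall>f\<in>F. dist (f y) (f x) < e} \<subseteq> f -` S"
    using assms(1) by (intro exI[of _ e] exI[of _ "{f}"] conjI) auto
qed

lemma continuous_map_initial: "f \<in> G \<Longrightarrow> continuous_map (initial_topology G) euclidean f"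
  using openin_initial_vimage[of f G] by (simp add: continuous_map_def vimage_def)

lemma openin_initial_ball:
  assumes "finite F" "F \<subseteq> G"
  shows "openin (initial_topology G) {y. \<forall>f\<in>F. dist (f y) (f x) < e}"
  using assms
proof (induction F rule: finite_induct)
  case empty
  then show ?case using openin_topspace[of "initial_topology G"] by simp
next
  case (insert g F)
  have "{y. \<forall>f\<in>insert g F. dist (f y) (f x) < e} = g -` ball (g x) e \<inter> {y. \<forall>f\<in>F. dist (f y) (f x) < e}"
    by (auto simp: dist_commute)
  moreover have "openin (initial_topology G) (g -` ball (g x) e)"
    using insert.prems by (intro openin_initial_vimage) auto
  moreover have "openin (initial_topology G) {y. \<forall>f\<in>F. dist (f y) (f x) < e}"
    using insert.prems insert.IH by simp
  ultimately show ?case by (simp only: openin_Int)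
qed

text \<open>Halving the radius of a basic neighbourhood and passing to non-strict inequalities gives
  a closed set in between.\<close>

lemma regular_space_initial_topology: "regular_space (initial_topology G)"
  unfolding neighbourhood_base_of_closedin [symmetric] neighbourhood_base_of
proof (intro allI impI)
  fix W x assume "openin (initial_topology G) W \<and> x \<in> W"
  then have "openin (initial_topology G) W" "x \<in> W" by auto
  then obtain e F where e: "e > 0" and F: "finite F" "F \<subseteq> G" and W: "{y. \<forall>f\<in>F. dist (f y) (f x) < e} \<subseteq> W"
    by (rule openin_initial_topologyE) (rule that)
  let ?U = "{y. \<forall>f\<in>F. dist (f y) (f x) < e/2}" and ?V = "{y. \<forall>f\<in>F. dist (f y) (f x) \<le> e/2}"
  have "- ?V = (\<Union>f\<in>F. f -` (- cball (f x) (e/2)))" by (auto simp: dist_commute not_le)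
  also have "openin (initial_topology G) \<dots>"
    using F by (intro openin_Union) (auto intro!: openin_initial_vimage)
  finally have "closedin (initial_topology G) ?V" by (simp add: closedin_def Compl_eq_Diff_UNIV)
  moreover have "openin (initial_topology G) ?U" by (rule openin_initial_ball[OF F])
  moreover have "x \<in> ?U" "?U \<subseteq> ?V" using e by auto
  moreover have "?V \<subseteq> {y. \<forall>f\<in>F. dist (f y) (f x) < e}" using e by auto
  then have "?V \<subseteq> W" using W by blast
  ultimately show "\<exists>U V. openin (initial_topology G) U \<and> closedin (initial_topology G) V \<and>
      x \<in> U \<and> U \<subseteq> V \<and> V \<subseteq> W"
    by (intro exI[of _ ?U] exI[of _ ?V]) simp
qed

lemma Hausdorff_space_initial_topology:
  assumes "\<And>x y. x \<noteq> y \<Longrightarrow> \<exists>f\<in>G. f x \<noteq> f y"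
  shows "Hausdorff_space (initial_topology G)"
  unfolding Hausdorff_space_def
proof (intro allI impI)
  fix x y :: 'a assume "x \<in> topspace (initial_topology G) \<and> y \<in> topspace (initial_topology G) \<and> x \<noteq> y"
  then obtain f where f: "f \<in> G" "f x \<noteq> f y" using assms by blast
  then obtain U V where "open U" "open V" "f x \<in> U" "f y \<in> V" "U \<inter> V = {}"
    using hausdorff by metis
  then show "\<exists>U V. openin (initial_topology G) U \<and> openin (initial_topology G) V \<and> x \<in> U \<and> y \<in> V \<and> disjnt U V"
    using f(1) by (intro exI[of _ "f -` U"] exI[of _ "f -` V"])
      (auto intro: openin_initial_vimage simp: disjnt_def)
qed

lemma open_if_openin_initial:
  assumes "\<And>f. f \<in> G \<Longrightarrow> continuous_on UNIV f" and U: "openin (initial_topology G) U"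
  shows "open U"
proof (subst open_subopen, intro ballI)
  fix x assume "x \<in> U"
  then obtain e F where e: "e > 0" and F: "finite F" "F \<subseteq> G" and W: "{y. \<forall>f\<in>F. dist (f y) (f x) < e} \<subseteq> U"
    by (rule openin_initial_topologyE[OF U]) (rule that)
  have "{y. \<forall>f\<in>F. dist (f y) (f x) < e} = (\<Inter>f\<in>F. {y. dist (f y) (f x) < e})" by auto
  also have "open \<dots>"
    using F assms(1) by (intro open_INT ballI open_Collect_less continuous_intros) auto
  finally show "\<exists>T. open T \<and> x \<in> T \<and> T \<subseteq> U" using e W by (intro exI[of _ "{y. \<forall>f\<in>F. dist (f y) (f x) < e}"]) auto
qed

text \<open>Basic balls are Euclidean open because \<open>G\<close> consists of continuous
  functions, so rational centres suffice. The balls are then indexed by a rational, a radius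
  \<open>1/(n+1)\<close> and a finite subset of \<open>G\<close>.\<close>

lemma initial_topology_base_lepoll:
  fixes G :: "(real \<Rightarrow> 'b::metric_space) set"
  assumes cont: "\<And>f. f \<in> G \<Longrightarrow> continuous_on UNIV f" and inf: "infinite K" and le: "G \<lesssim> K"
  obtains B where "is_base_of B (initial_topology G)" "B \<lesssim> K"
proof -
  define b where "b = (\<lambda>(q :: real, n :: nat, F :: (real \<Rightarrow> 'b) set). {y. \<forall>f\<in>F. dist (f y) (f q) < inverse (real (Suc n))} :: real set)"
  define I where "I = (\<rat> :: real set) \<times> (UNIV :: nat set) \<times> Fpow G"
  have "is_base_of (b ` I) (initial_topology G)"
    unfolding is_base_of_def
  proof (intro conjI ballI allI impI)
    show "openin (initial_topology G) U" if "U \<in> b ` I" for U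
      using that by (auto simp: b_def I_def Fpow_def intro: openin_initial_ball)
    fix U assume U: "openin (initial_topology G) U"
    have "\<exists>i\<in>I. x \<in> b i \<and> b i \<subseteq> U" if x: "x \<in> U" for x
    proof -
      obtain e F where e: "e > 0" and F: "finite F" "F \<subseteq> G" and W: "{y. \<forall>f\<in>F. dist (f y) (f x) < e} \<subseteq> U"
        by (rule openin_initial_topologyE[OF U x]) (rule that)
      obtain n where n: "inverse (real (Suc n)) < e/2"
        using reals_Archimedean[of "e/2"] e by auto
      let ?N = "{y. \<forall>f\<in>F. dist (f y) (f x) < inverse (real (Suc n))}"
      have "open ?N"
        by (rule open_if_openin_initial[OF cont openin_initial_ball[OF F]])
      moreover have "x \<in> ?N" by simp
      ultimately obtain q where q: "q \<in> \<rat>" "q \<in> ?N"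
        using open_Int_closure_eq_empty[of ?N "\<rat>"] Rats_closure_real by blast
      have "x \<in> b (q, n, F)" using q by (auto simp: b_def dist_commute)
      moreover have "b (q, n, F) \<subseteq> U"
      proof
        fix y assume y: "y \<in> b (q, n, F)"
        have "dist (f y) (f x) < e" if "f \<in> F" for f
        proof -
          have "dist (f y) (f x) \<le> dist (f y) (f q) + dist (f q) (f x)" by (rule dist_triangle)
          also have "\<dots> < e" using y q that n by (force simp: b_def)
          finally show ?thesis .
        qed
        then show "y \<in> U" using W by blast
      qed
      ultimately show ?thesis using q F by (auto simp: I_def Fpow_def intro!: bexI[of _ "(q, n, F)"])
    qed
    then show "\<exists>C\<subseteq>b ` I. \<Union> C = U"
      by (intro exI[of _ "{b i |i. i \<in> I \<and> b i \<subseteq> U}"]) blast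
  qed
  moreover have "b ` I \<lesssim> K"
  proof -
    obtain h where "inj_on h G" "h ` G \<subseteq> K" using le by (auto simp: lepoll_def)
    then have "inj_on ((`) h) (Fpow G)" "(`) h ` Fpow G \<subseteq> Fpow K"
      by (auto simp: inj_on_image_Fpow image_Fpow_mono)
    then have "Fpow G \<lesssim> Fpow K" by (auto simp: lepoll_def)
    also have "Fpow K \<lesssim> K" by (rule Fpow_lepoll[OF inf])
    finally have "Fpow G \<lesssim> K" .
    moreover have "(\<rat> :: real set) \<lesssim> K" "(UNIV :: nat set) \<lesssim> K"
      using inf by (simp_all add: nat_lepoll_infinite countable_rat)
    ultimately have "I \<lesssim> K"
      unfolding I_def by (intro times_lepoll_infinite[OF inf])
    then show ?thesis using image_lepoll lepoll_trans by blast
  qed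
  ultimately show ?thesis using that by blast
qed

section \<open>Coarse topologies on the line\<close>

text \<open>Every cover by sets open in a subspace of \<open>X\<close> is also a cover by relatively
  open sets of the original second countable space. Hence all subspaces are Lindelof, and regular
  Lindelof spaces are normal.\<close>

lemma completely_normal_space_coarse:
  fixes X :: "'a::second_countable_topology topology"
  assumes top: "topspace X = UNIV" and haus: "Hausdorff_space X" and reg: "regular_space X"
    and coarse: "\<And>U. openin X U \<Longrightarrow> open U"
  shows "completely_normal_space X"
  unfolding completely_normal_space_def hereditarily
proof (intro conjI allI)
  show "t1_space X" using haus by (simp add: Hausdorff_imp_t1_space)
  fix S
  have "Lindelof_space (subtopology X S)"
    unfolding Lindelof_space_def
  proof (intro allI impI)
    fix \<U> assume *: "(\<forall>U\<in>\<U>. openin (subtopology X S) U) \<and> \<Union> \<U> = topspace (subtopology X S)"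
    have "openin (top_of_set S) U" if U: "U \<in> \<U>" for U
    proof -
      have "openin (subtopology X S) U" using * U by blast
      then obtain V where "openin X V" "U = V \<inter> S" unfolding openin_subtopology by auto
      then show ?thesis using coarse[of V] by (auto simp: openin_open)
    qed
    from Lindelof_openin[of \<U> S, OF this]
    obtain \<V> where V: "\<V> \<subseteq> \<U>" "countable \<V>" "\<Union>\<V> = \<Union>\<U>" by blast
    then show "\<exists>\<V>. countable \<V> \<and> \<V> \<subseteq> \<U> \<and> \<Union> \<V> = topspace (subtopology X S)"
      using * by (intro exI[of _ \<V>]) simp
  qed
  then show "normal_space (subtopology X S)"
    using reg by (simp add: regular_Lindelof_imp_normal_space regular_space_subtopology)
qed

text \<open>Closed balls stay compact in the coarser topology, hence closed by the Hausdorff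
  property, and a bounded set has no interior by \<open>unb\<close>.\<close>

lemma first_category_coarse:
  fixes X :: "'a::heine_borel topology"
  assumes top: "topspace X = UNIV" and haus: "Hausdorff_space X"
    and coarse: "\<And>U. openin X U \<Longrightarrow> open U"
    and unb: "\<And>U. openin X U \<Longrightarrow> U \<noteq> {} \<Longrightarrow> \<not> bounded U"
  shows "first_category X"
  unfolding first_category_def
proof (intro exI conjI allI)
  fix n :: nat
  \<comment> \<open>The centre is irrelevant, so \<open>undefined\<close> stands for an arbitrary
    point.\<close>
  let ?B = "cball undefined (real n) :: 'a set"
  have "continuous_map euclidean X id"
    using coarse top by (simp add: continuous_map_def)
  then have "compactin X (id ` ?B)"
    by (intro image_compactin) auto
  then have "closedin X ?B" using compactin_imp_closedin haus by fastforce
  then have "X closure_of ?B = ?B" by (simp add: closure_of_closedin)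
  moreover have "X interior_of ?B = {}"
    using unb[OF openin_interior_of] bounded_subset[OF bounded_cball interior_of_subset] by blast
  ultimately show "nowhere_dense_in X ?B" by (simp add: nowhere_dense_in_def top)
next
  show "topspace X = (\<Union>n. cball undefined (real n))"
    unfolding top using real_arch_simple by (auto simp: set_eq_iff)
qed

section \<open>The winding norm\<close>

text \<open>The distance, in the sum metric of the torus, between the image of \<open>t\<close> and
  the image of \<open>0\<close>. Thus \<open>wnorm (s - t)\<close> is the translation-invariant
  metric induced by the winding.\<close>

definition wnorm :: "real \<Rightarrow> real" where
  "wnorm t = cmod (cis t - 1) + cmod (cis (sqrt 2 * t) - 1)"

lemma wnorm_0 [simp]: "wnorm 0 = 0"
  by (simp add: wnorm_def)

lemma wnorm_nonneg [simp]: "0 \<le> wnorm t"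
  by (simp add: wnorm_def)

lemma wnorm_diff: "wnorm (s - t) = dist (cis s) (cis t) + dist (cis (sqrt 2 * s)) (cis (sqrt 2 * t))"
proof -
  have "dist (cis a) (cis b) = cmod (cis (a - b) - 1)" for a b
  proof -
    have "cis a - cis b = cis b * (cis (a - b) - 1)" by (simp add: algebra_simps cis_mult)
    then show ?thesis by (simp add: dist_norm norm_mult)
  qed
  then show ?thesis by (simp add: wnorm_def right_diff_distrib)
qed

lemma wnorm_minus_commute: "wnorm (s - t) = wnorm (t - s)"
  by (simp add: wnorm_diff dist_commute)

lemma wnorm_minus [simp]: "wnorm (- t) = wnorm t"
  using wnorm_minus_commute[of 0 t] by simp

lemma wnorm_diff_triangle: "wnorm (a - c) \<le> wnorm (a - b) + wnorm (b - c)"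
  using dist_triangle[of "cis a" "cis c" "cis b"]
    dist_triangle[of "cis (sqrt 2 * a)" "cis (sqrt 2 * c)" "cis (sqrt 2 * b)"]
  by (simp add: wnorm_diff)

lemma wnorm_triangle: "wnorm (s + t) \<le> wnorm s + wnorm t"
  using wnorm_diff_triangle[of s "- t" 0] by simp

lemma continuous_on_wnorm [continuous_intros]:
  "continuous_on S f \<Longrightarrow> continuous_on S (\<lambda>x. wnorm (f x))"
  unfolding wnorm_def by (intro continuous_intros)

text \<open>Squaring gives \<open>2 * m^2 = n^2\<close>, where the prime 2 would have odd
  multiplicity on the left and even multiplicity on the right.\<close>

lemma sqrt_2_irrational:
  fixes m n :: int
  assumes "sqrt 2 * of_int m = of_int n"
  shows "m = 0"
proof (rule ccontr)
  assume m: "m \<noteq> 0"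
  have "(sqrt 2 * of_int m)\<^sup>2 = (of_int n)\<^sup>2" using assms by simp
  then have "of_int (2 * m\<^sup>2) = (of_int (n\<^sup>2) :: real)" by (simp add: power_mult_distrib)
  then have eq: "2 * m\<^sup>2 = n\<^sup>2" unfolding of_int_eq_iff .
  then have n: "n \<noteq> 0" using m by auto
  have "multiplicity 2 (2 * m\<^sup>2) = 1 + 2 * multiplicity 2 m"
    using m by (simp add: prime_elem_multiplicity_mult_distrib prime_elem_multiplicity_power_distrib)
  moreover have "multiplicity 2 (n\<^sup>2) = 2 * multiplicity 2 n"
    using n by (simp add: prime_elem_multiplicity_power_distrib)
  ultimately have "1 + 2 * multiplicity 2 m = 2 * multiplicity 2 n" using eq by simp
  then show False by presburger
qed

lemma cis_eq_1E:
  assumes "cis t = 1" obtains n :: int where "t = of_int n * (2 * pi)"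
proof -
  have "cos t = 1" using assms by (simp add: complex_eq_iff)
  then show ?thesis using that by (auto simp: cos_one_2pi_int)
qed

text \<open>The winding is injective: \<open>wnorm t = 0\<close> puts both \<open>t\<close> and
  \<open>sqrt 2 * t\<close> into the integer multiples of \<open>2 * pi\<close>, which irrationality
  allows only for \<open>t = 0\<close>.\<close>

lemma wnorm_pos: "t \<noteq> 0 \<Longrightarrow> 0 < wnorm t"
proof (rule ccontr)
  assume t: "t \<noteq> 0" and "\<not> 0 < wnorm t"
  then have "cmod (cis t - 1) + cmod (cis (sqrt 2 * t) - 1) \<le> 0" by (simp add: wnorm_def)
  moreover have "0 \<le> cmod (cis t - 1)" "0 \<le> cmod (cis (sqrt 2 * t) - 1)" by simp_all
  ultimately have "cmod (cis t - 1) = 0" "cmod (cis (sqrt 2 * t) - 1) = 0" by linarith+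
  then have "cis t = 1" "cis (sqrt 2 * t) = 1" by simp_all
  then obtain m n :: int where m: "t = of_int m * (2 * pi)" and n: "sqrt 2 * t = of_int n * (2 * pi)"
    by (metis cis_eq_1E)
  then have "(sqrt 2 * of_int m) * (2 * pi) = of_int n * (2 * pi)" by simp
  then have "sqrt 2 * of_int m = of_int n" by simp
  then have "m = 0" by (rule sqrt_2_irrational)
  then show False using t m by simp
qed

text \<open>By compactness of the torus the images of the natural numbers have a Cauchy subsequence.
  Differences of two far-out terms are then short in \<open>wnorm\<close> but can be made
  arbitrarily large.\<close>

lemma wnorm_recurrent:
  assumes "e > 0" obtains t where "M < t" "wnorm t < e"
proof -
  let ?p = "\<lambda>n::nat. (cis (real n), cis (sqrt 2 * real n))"
  have "seq_compact (sphere 0 1 \<times> sphere 0 1 :: (complex \<times> complex) set)"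
    by (intro compact_imp_seq_compact compact_Times compact_sphere)
  moreover have "\<forall>n. ?p n \<in> sphere 0 1 \<times> sphere 0 1" by simp
  ultimately obtain l r where r: "strict_mono r" and "(?p \<circ> r) \<longlonglongrightarrow> l"
    by (rule seq_compactE) (rule that)
  then have "Cauchy (?p \<circ> r)" by (blast intro: LIMSEQ_imp_Cauchy)
  then obtain N where N: "\<forall>m\<ge>N. \<forall>n\<ge>N. dist ((?p \<circ> r) m) ((?p \<circ> r) n) < e/2"
    using assms metric_CauchyD half_gt_zero by blast
  \<comment> \<open>Large enough for the Cauchy condition and, because \<open>r n \<ge> n\<close>,
    for \<open>r n - r N\<close> to exceed \<open>M\<close>.\<close>
  define n where "n = N + r N + nat \<lceil>M\<rceil> + 1"
  have "real (r n) \<ge> real n" using seq_suble[OF r, of n] by simp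
  moreover have "real n \<ge> real (r N) + M + 1" unfolding n_def using real_nat_ceiling_ge[of M] by simp
  ultimately have M: "M < real (r n) - real (r N)" by simp
  have d: "dist (?p (r n)) (?p (r N)) < e/2" using N[rule_format, of n N] by (simp add: n_def)
  have "dist (cis (real (r n))) (cis (real (r N))) < e/2"
    using dist_fst_le[of "?p (r n)" "?p (r N)"] d by simp
  moreover have "dist (cis (sqrt 2 * real (r n))) (cis (sqrt 2 * real (r N))) < e/2"
    using dist_snd_le[of "?p (r n)" "?p (r N)"] d by simp
  ultimately have "wnorm (real (r n) - real (r N)) < e" by (simp add: wnorm_diff)
  with M show ?thesis by (rule that)
qed

text \<open>A nowhere vanishing continuous function on a contractible domain has a continuous
  logarithm; its imaginary part is \<open>u\<close>.\<close>

lemma continuous_cis_lift: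
  assumes "continuous_on UNIV (\<lambda>t::real. cis (f t))"
  obtains u n where "continuous_on UNIV u" "\<And>t. f t = u t + of_int (n t) * (2 * pi)"
proof -
  obtain g where g: "continuous_on UNIV g" "\<And>t. cis (f t) = exp (g t)"
    using continuous_logarithm_on_contractible[OF assms contractible_UNIV] by (metis UNIV_I cis_neq_zero)
  have "cis (f t - Im (g t)) = 1" for t
  proof -
    have e: "cis (f t) = of_real (exp (Re (g t))) * cis (Im (g t))"
      using g(2)[of t] by (simp add: exp_eq_polar)
    have "1 = cmod (of_real (exp (Re (g t))) * cis (Im (g t)))" unfolding e [symmetric] by simp
    then have "exp (Re (g t)) = 1" by (simp add: norm_mult)
    then have "cis (f t) = cis (Im (g t))" using e by simp
    then show ?thesis by (simp flip: cis_divide)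
  qed
  then have "\<exists>n::int. f t - Im (g t) = of_int n * (2 * pi)" for t by (metis cis_eq_1E)
  then obtain n :: "real \<Rightarrow> int" where "\<And>t. f t - Im (g t) = of_int (n t) * (2 * pi)" by metis
  moreover have "continuous_on UNIV (\<lambda>t. Im (g t))" using g(1) by (intro continuous_intros)
  ultimately show ?thesis using that[of "\<lambda>t. Im (g t)" n] by (simp add: algebra_simps)
qed

text \<open>A path in the winding line lifts to the plane, where the preimage of the line is a countable
  union of parallel lines; by connectedness the lift stays on one of them.\<close>

lemma continuous_on_if_winding_continuous:
  fixes f :: "real \<Rightarrow> real"
  assumes "continuous_on UNIV (\<lambda>t. cis (f t))" "continuous_on UNIV (\<lambda>t. cis (sqrt 2 * f t))"
  shows "continuous_on UNIV f"
proof -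
  obtain u m where u: "continuous_on UNIV u" "\<And>t. f t = u t + of_int (m t) * (2 * pi)"
    using continuous_cis_lift[OF assms(1)] by metis
  obtain v n where v: "continuous_on UNIV v" "\<And>t. sqrt 2 * f t = v t + of_int (n t) * (2 * pi)"
    using continuous_cis_lift[OF assms(2)] by metis
  \<comment> \<open>\<open>w\<close> tells which of the parallel lines of slope
    \<open>sqrt 2\<close> contains the lifted point \<open>(u t, v t)\<close>.\<close>
  define w where "w t = v t - sqrt 2 * u t" for t
  have w: "w t = (sqrt 2 * of_int (m t) - of_int (n t)) * (2 * pi)" for t
    using u(2)[of t] v(2)[of t] by (simp add: w_def algebra_simps)
  have "connected (range w)"
    unfolding w_def using u(1) v(1) by (intro connected_continuous_image continuous_intros) auto
  moreover have "countable (range w)"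
  proof (rule countable_subset)
    show "range w \<subseteq> range (\<lambda>(m::int, n::int). (sqrt 2 * of_int m - of_int n) * (2 * pi))"
      using w by (auto intro!: image_eqI[of _ _ "(m t, n t)" for t])
  qed simp
  ultimately have const: "w s = w t" for s t using connected_uncountable[of "range w"] by blast
  \<comment> \<open>By irrationality the line determines the pair of integers, so constancy of
    \<open>w\<close> gives constancy of \<open>m\<close>.\<close>
  have "m t = m 0" for t
  proof -
    have "sqrt 2 * of_int (m t) - of_int (n t) = sqrt 2 * of_int (m 0) - of_int (n 0)"
      using const[of t 0] unfolding w by simp
    then have "sqrt 2 * of_int (m t - m 0) = of_int (n t - n 0)" by (simp add: algebra_simps)
    then have "m t - m 0 = 0" by (rule sqrt_2_irrational)
    then show ?thesis by simp
  qed
  then have "f = (\<lambda>t. u t + of_int (m 0) * (2 * pi))" using u(2) by (metis ext)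
  then show ?thesis using u(1) by (simp add: continuous_on_add)
qed

section \<open>Bumps accumulating at the origin\<close>

text \<open>\<open>decay\<close> and \<open>r_le\<close> put the bumps into disjoint annuli around
  \<open>0\<close>, \<open>away\<close> makes them vanish on \<open>[-1, 1]\<close>, and
  \<open>r_le_1\<close> ensures that the edge of a bump is reached within Euclidean distance 1 of
  its centre.\<close>

locale bumps =
  fixes c r :: "nat \<Rightarrow> real"
  assumes decay: "wnorm (c (Suc k)) \<le> wnorm (c k) / 4"
    and r_pos: "0 < r k"
    and r_le: "r k \<le> wnorm (c k) / 4"
    and r_le_1: "r k \<le> wnorm 1"
    and away: "\<bar>s\<bar> \<le> 1 \<Longrightarrow> r k \<le> wnorm (s - c k)"

lemma wnorm_segment_bound:
  assumes "0 < a" obtains d where "0 < d" "\<And>s. a \<le> s \<Longrightarrow> s \<le> b \<Longrightarrow> d \<le> wnorm s"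
proof (cases "a \<le> b")
  case True
  have "continuous_on {a..b} wnorm" using continuous_on_wnorm[OF continuous_on_id] by simp
  then obtain x where x: "x \<in> {a..b}" "\<And>y. y \<in> {a..b} \<Longrightarrow> wnorm x \<le> wnorm y"
    using continuous_attains_inf[of "{a..b}" wnorm] True by auto
  show ?thesis
    using that[of "wnorm x"] x wnorm_pos[of x] assms by auto
qed (use that[of 1] in auto)

text \<open>Recurrence supplies the centres one after the other. Keeping them beyond 2 separates
  them from \<open>[-1, 1]\<close>, so that compactness yields a positive lower bound
  \<open>d k\<close> for \<open>away\<close>.\<close>

lemma bumps_exist: obtains c r where "bumps c r"
proof -
  have "\<exists>c. \<forall>k. 2 < c k \<and> wnorm (c (Suc k)) \<le> wnorm (c k) / 4"
  proof (rule dependent_nat_choice)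
    show "\<exists>x::real. 2 < x" by (rule gt_ex)
    fix x :: real assume "2 < x"
    then have "0 < wnorm x / 4" using wnorm_pos by simp
    then obtain y where "2 < y" "wnorm y < wnorm x / 4" by (rule wnorm_recurrent)
    then show "\<exists>y>2. wnorm y \<le> wnorm x / 4" by (intro exI[of _ y]) simp
  qed
  then obtain c where c: "\<And>k. 2 < c k" "\<And>k. wnorm (c (Suc k)) \<le> wnorm (c k) / 4" by blast
  have "\<exists>d>0. \<forall>s. \<bar>s\<bar> \<le> 1 \<longrightarrow> d \<le> wnorm (s - c k)" for k
  proof -
    have "0 < c k - 1" using c(1)[of k] by simp
    then obtain d where d: "0 < d" "\<And>s. c k - 1 \<le> s \<Longrightarrow> s \<le> c k + 1 \<Longrightarrow> d \<le> wnorm s"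
      using wnorm_segment_bound[of "c k - 1" "c k + 1"] by metis
    have "d \<le> wnorm (s - c k)" if "\<bar>s\<bar> \<le> 1" for s
      using d(2)[of "c k - s"] that by (simp add: wnorm_minus_commute abs_le_iff)
    with d(1) show ?thesis by blast
  qed
  then obtain d where d: "\<And>k. 0 < d k" "\<And>k s. \<bar>s\<bar> \<le> 1 \<Longrightarrow> d k \<le> wnorm (s - c k)" by metis
  have pos: "0 < wnorm (c k)" for k using wnorm_pos[of "c k"] c(1)[of k] by simp
  have "bumps c (\<lambda>k. min (d k) (min (wnorm (c k) / 4) (wnorm 1)))"
  proof
    show "min (d k) (min (wnorm (c k) / 4) (wnorm 1)) \<le> wnorm (s - c k)" if "\<bar>s\<bar> \<le> 1" for k s
      using d(2)[OF that, of k] by linarith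
  qed (use c(2) d(1) pos wnorm_pos[of 1] in auto)
  then show ?thesis by (rule that)
qed

context bumps
begin

lemma wnorm_c_pos: "0 < wnorm (c k)"
  using r_pos[of k] r_le[of k] by linarith

lemma wnorm_c_less:
  assumes "k < l" shows "wnorm (c l) \<le> wnorm (c k) / 4"
proof -
  have "wnorm (c (Suc (k + j))) \<le> wnorm (c k) / 4" for j
  proof (induction j)
    case 0
    then show ?case using decay[of k] by simp
  next
    case (Suc j)
    then show ?case using decay[of "Suc (k + j)"] wnorm_nonneg[of "c (Suc (k + j))"]
      by (simp del: wnorm_nonneg)
  qed
  then show ?thesis using less_imp_Suc_add[OF assms] by auto
qed

lemma wnorm_c_small:
  assumes "0 < e" obtains m where "\<And>k. m \<le> k \<Longrightarrow> wnorm (c k) < e"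
proof -
  have le: "wnorm (c k) \<le> wnorm (c 0) * (1/4) ^ k" for k
  proof (induction k)
    case (Suc k)
    then show ?case using decay[of k] by simp
  qed simp
  have "(\<lambda>k. wnorm (c 0) * (1/4) ^ k) \<longlonglongrightarrow> wnorm (c 0) * 0"
    by (intro tendsto_intros LIMSEQ_power_zero) simp
  then have "eventually (\<lambda>k. wnorm (c 0) * (1/4) ^ k < e) sequentially"
    using assms by (intro order_tendstoD) auto
  then obtain m where m: "\<And>k. m \<le> k \<Longrightarrow> wnorm (c 0) * (1/4) ^ k < e"
    by (auto simp: eventually_sequentially)
  show ?thesis using that[of m] le m order_le_less_trans by blast
qed

text \<open>A tent measured with \<open>wnorm\<close> rather than the absolute value, so that each
  single bump is already continuous in the winding topology.\<close>

definition bump :: "nat \<Rightarrow> real \<Rightarrow> real" where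
  "bump k t = max 0 (1 - wnorm (t - c k) / r k)"

text \<open>At each point at most one term is nonzero, so no question of convergence arises.\<close>

definition bumpsum :: "nat set \<Rightarrow> real \<Rightarrow> real" where
  "bumpsum X t = (\<Sum>k. if k \<in> X then bump k t else 0)"

lemma bump_eq_0: "r k \<le> wnorm (t - c k) \<Longrightarrow> bump k t = 0"
  using r_pos[of k] by (simp add: bump_def max_def)

lemma bump_nonneg: "0 \<le> bump k t"
  by (simp add: bump_def)

lemma bump_center: "bump k (c k) = 1"
  by (simp add: bump_def)

lemma bump_Lipschitz: "\<bar>bump k s - bump k t\<bar> \<le> wnorm (s - t) / r k"
proof -
  have "\<bar>bump k s - bump k t\<bar> \<le> \<bar>wnorm (t - c k) / r k - wnorm (s - c k) / r k\<bar>"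
    by (auto simp: bump_def)
  also have "\<dots> = \<bar>wnorm (t - c k) - wnorm (s - c k)\<bar> / r k"
    using r_pos[of k] by (simp flip: diff_divide_distrib)
  also have "\<dots> \<le> wnorm (s - t) / r k"
    using wnorm_diff_triangle[of s "c k" t] wnorm_diff_triangle[of t "c k" s] r_pos[of k]
    by (intro divide_right_mono) (auto simp: wnorm_minus_commute[of t s])
  finally show ?thesis .
qed

lemma bump_annulus:
  assumes "wnorm (t - c k) \<le> r k"
  shows "3/4 * wnorm (c k) \<le> wnorm t" "wnorm t \<le> 5/4 * wnorm (c k)"
  using wnorm_diff_triangle[of "c k" 0 t] wnorm_diff_triangle[of t 0 "c k"] assms r_le[of k]
  by (simp_all add: wnorm_minus_commute[of "c k" t])

text \<open>The annuli given by \<open>bump_annulus\<close> cannot meet: of two centres one has at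
  most a quarter of the norm of the other, and \<open>5/4 * 1/4 < 3/4\<close>.\<close>

lemma bumps_disjoint:
  assumes "wnorm (t - c k) \<le> r k" "k \<noteq> l" shows "r l \<le> wnorm (t - c l)"
proof (rule ccontr)
  assume "\<not> r l \<le> wnorm (t - c l)"
  then have "wnorm (t - c l) \<le> r l" by simp
  note bump_annulus[OF this] bump_annulus[OF assms(1)]
  moreover have "wnorm (c l) \<le> wnorm (c k) / 4 \<or> wnorm (c k) \<le> wnorm (c l) / 4"
    using wnorm_c_less[of k l] wnorm_c_less[of l k] assms(2) by linarith
  ultimately show False using wnorm_c_pos[of k] wnorm_c_pos[of l] by linarith
qed

lemma bumpsum_in:
  assumes "wnorm (t - c k) \<le> r k" shows "bumpsum X t = (if k \<in> X then bump k t else 0)"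
proof -
  have "bumpsum X t = (\<Sum>j\<in>{k}. if j \<in> X then bump j t else 0)"
    unfolding bumpsum_def
    by (rule suminf_finite) (use bump_eq_0[OF bumps_disjoint[OF assms]] in auto)
  then show ?thesis by simp
qed

lemma bumpsum_out: "(\<And>k. r k \<le> wnorm (t - c k)) \<Longrightarrow> bumpsum X t = 0"
  unfolding bumpsum_def by (subst suminf_finite[of "{}"]) (auto simp: bump_eq_0)

lemma bumpsum_center: "bumpsum X (c k) = (if k \<in> X then 1 else 0)"
  using bumpsum_in[of "c k" k X] r_pos[of k] by (simp add: bump_center)

lemma bumpsum_near_0: "\<bar>t\<bar> \<le> 1 \<Longrightarrow> bumpsum X t = 0"
  using away by (intro bumpsum_out)

lemma bumpsum_nonneg: "0 \<le> bumpsum X t"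
proof (cases "\<exists>k. wnorm (t - c k) \<le> r k")
  case True
  then show ?thesis using bumpsum_in bump_nonneg by force
next
  case False
  then have "bumpsum X t = 0" by (intro bumpsum_out) (meson linear)
  then show ?thesis by simp
qed

text \<open>The intermediate value theorem finds \<open>s\<close> with \<open>wnorm s = r k\<close>;
  since \<open>wnorm\<close> is even, both \<open>c k - s\<close> and \<open>c k + s\<close> lie on
  the edge of the bump, where every bump sum vanishes.\<close>

lemma bump_boundary:
  obtains s where "0 < s" "s \<le> 1"
    "\<And>t X. t = c k - s \<or> t = c k + s \<Longrightarrow> bumpsum X t = 0 \<and> wnorm t < 2 * wnorm (c k)"
proof -
  have "continuous_on {0..1} wnorm" using continuous_on_wnorm[OF continuous_on_id] by simp
  then obtain s where s: "0 \<le> s" "s \<le> 1" "wnorm s = r k"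
    using IVT'[of wnorm 0 "r k" 1] r_pos[of k] r_le_1[of k] by auto
  have "bumpsum X t = 0 \<and> wnorm t < 2 * wnorm (c k)" if "t = c k - s \<or> t = c k + s" for t X
  proof -
    have eq: "wnorm (t - c k) = r k" using that s(3) by auto
    then show ?thesis
      using bumpsum_in[of t k X] bump_eq_0[of k t] bump_annulus(2)[of t k] wnorm_c_pos[of k] by auto
  qed
  moreover have "0 < s" using s(1,3) r_pos[of k] by (cases "s = 0") auto
  ultimately show ?thesis using that s(2) by blast
qed

text \<open>The supports accumulate only at \<open>0\<close>. Near any other point just finitely
  many bumps are active, and each of them is Lipschitz for \<open>wnorm\<close>.\<close>

lemma bumpsum_wnorm_continuous:
  assumes z: "z \<noteq> 0" and e: "0 < e"
  obtains d where "0 < d" "\<And>s. wnorm (s - z) < d \<Longrightarrow> \<bar>bumpsum X s - bumpsum X z\<bar> < e"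
proof -
  \<comment> \<open>Points closer than \<open>a\<close> to \<open>z\<close> have norm above
    \<open>a\<close>, whereas a bump with \<open>wnorm (c k) < a / 2\<close> lives at norms at most
    \<open>5/8 * a\<close>.\<close>
  define a where "a = wnorm z / 2"
  have a: "0 < a" using wnorm_pos[OF z] by (simp add: a_def)
  then have "0 < a / 2" by simp
  then obtain m where m: "\<And>k. m \<le> k \<Longrightarrow> wnorm (c k) < a / 2" using wnorm_c_small by blast
  have local: "bumpsum X s = (\<Sum>k<m. if k \<in> X then bump k s else 0)" if "wnorm (s - z) < a" for s
    unfolding bumpsum_def
  proof (rule suminf_finite)
    fix k assume "k \<notin> {..<m}"
    then have "wnorm (c k) < a / 2" using m by simp
    moreover have "a < wnorm s"
      using that wnorm_diff_triangle[of z 0 s] by (simp add: a_def wnorm_minus_commute[of s z])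
    ultimately have "r k \<le> wnorm (s - c k)"
      using bump_annulus(2)[of s k] wnorm_c_pos[of k] by fastforce
    then show "(if k \<in> X then bump k s else 0) = 0" by (simp add: bump_eq_0)
  qed simp
  define R where "R = (\<Sum>k<m. 1 / r k)"
  have R: "0 \<le> R" unfolding R_def using r_pos by (intro sum_nonneg) (simp add: less_imp_le)
  show ?thesis
  proof
    \<comment> \<open>The summand 1 keeps the denominator positive when \<open>R = 0\<close>, as
      happens for \<open>m = 0\<close>.\<close>
    show "0 < min a (e / (1 + R))" using a e R by simp
    fix s assume "wnorm (s - z) < min a (e / (1 + R))"
    then have s: "wnorm (s - z) < a" "wnorm (s - z) * (1 + R) < e"
      using R by (simp_all add: pos_less_divide_eq)
    have "\<bar>bumpsum X s - bumpsum X z\<bar> =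
        \<bar>\<Sum>k<m. (if k \<in> X then bump k s else 0) - (if k \<in> X then bump k z else 0)\<bar>"
      using local[OF s(1)] local[of z] a by (simp add: sum_subtractf)
    also have "\<dots> \<le> (\<Sum>k<m. wnorm (s - z) / r k)"
      by (intro order_trans[OF sum_abs] sum_mono) (use bump_Lipschitz r_pos in \<open>auto simp: less_imp_le\<close>)
    also have "\<dots> = wnorm (s - z) * R" by (simp add: R_def sum_distrib_left)
    also have "\<dots> \<le> wnorm (s - z) * (1 + R)" by (intro mult_left_mono) auto
    finally show "\<bar>bumpsum X s - bumpsum X z\<bar> < e" using s(2) by simp
  qed
qed

text \<open>At \<open>0\<close> the function is constant on a Euclidean neighbourhood; elsewhere
  continuity for \<open>wnorm\<close> implies Euclidean continuity.\<close>

lemma continuous_on_bumpsum: "continuous_on UNIV (bumpsum X)"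
proof (rule continuous_at_imp_continuous_on, rule ballI)
  fix z :: real
  show "isCont (bumpsum X) z"
    unfolding isCont_def
  proof (rule tendstoI)
    fix e :: real assume e: "0 < e"
    show "\<forall>\<^sub>F s in at z. dist (bumpsum X s) (bumpsum X z) < e"
    proof (cases "z = 0")
      case True
      have "\<forall>\<^sub>F s in at z. dist s z < 1" using tendstoD[OF tendsto_ident_at, of 1] by simp
      then show ?thesis
        by eventually_elim (use True e in \<open>simp add: bumpsum_near_0 dist_real_def\<close>)
    next
      case False
      obtain d where d: "0 < d" "\<And>s. wnorm (s - z) < d \<Longrightarrow> \<bar>bumpsum X s - bumpsum X z\<bar> < e"
        using bumpsum_wnorm_continuous[OF False e] by metis
      have "continuous_on UNIV (\<lambda>s. wnorm (s - z))" by (intro continuous_intros)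
      then have "((\<lambda>s. wnorm (s - z)) \<longlongrightarrow> wnorm (z - z)) (at z)"
        unfolding continuous_on_eq_continuous_at[OF open_UNIV] isCont_def by blast
      then have "\<forall>\<^sub>F s in at z. wnorm (s - z) < d" using d(1) by (intro order_tendstoD) auto
      then show ?thesis by eventually_elim (use d(2) in \<open>simp add: dist_real_def\<close>)
    qed
  qed
qed

section \<open>Topologies with prescribed bumps\<close>

text \<open>A pair \<open>(x, X)\<close> makes the translate of \<^term>\<open>bumpsum X\<close> to \<open>x\<close> continuous; this changes the
  winding topology at the point \<open>x\<close> only.\<close>

definition gens :: "(real \<times> nat set) set \<Rightarrow> (real \<Rightarrow> complex) set" where
  "gens P = {cis, \<lambda>t. cis (sqrt 2 * t)} \<union> (\<lambda>(x, X) t. of_real (bumpsum X (t - x))) ` P"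

definition btop :: "(real \<times> nat set) set \<Rightarrow> real topology" where
  "btop P = initial_topology (gens P)"

lemma topspace_btop [simp]: "topspace (btop P) = UNIV"
  by (simp add: btop_def)

lemma continuous_gens: "f \<in> gens P \<Longrightarrow> continuous_on UNIV f"
proof -
  have "continuous_on UNIV (\<lambda>t. complex_of_real (bumpsum X (t - x)))" for X x
    by (intro continuous_on_of_real continuous_on_compose2[OF continuous_on_bumpsum] continuous_intros) auto
  moreover have "continuous_on UNIV cis" "continuous_on UNIV (\<lambda>t. cis (sqrt 2 * t))"
    by (intro continuous_intros)+
  ultimately show "f \<in> gens P \<Longrightarrow> continuous_on UNIV f" by (auto simp: gens_def)
qed

lemma open_if_openin_btop: "openin (btop P) U \<Longrightarrow> open U"
  unfolding btop_def by (rule open_if_openin_initial[OF continuous_gens])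

lemma continuous_map_btopD:
  "continuous_map (btop P) euclidean f \<Longrightarrow> continuous_on UNIV f"
  unfolding continuous_map_def continuous_on_open_vimage[OF open_UNIV]
  using open_if_openin_btop by (auto simp: vimage_def)

lemma regular_space_btop: "regular_space (btop P)"
  unfolding btop_def by (rule regular_space_initial_topology)

lemma Hausdorff_space_btop: "Hausdorff_space (btop P)"
  unfolding btop_def
proof (rule Hausdorff_space_initial_topology)
  fix x y :: real assume "x \<noteq> y"
  then have "0 < wnorm (x - y)" by (intro wnorm_pos) simp
  then have "cis x \<noteq> cis y \<or> cis (sqrt 2 * x) \<noteq> cis (sqrt 2 * y)" by (auto simp: wnorm_diff)
  then show "\<exists>f\<in>gens P. f x \<noteq> f y" by (auto simp: gens_def)
qed

lemma completely_normal_space_btop: "completely_normal_space (btop P)"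
  by (rule completely_normal_space_coarse[OF topspace_btop Hausdorff_space_btop regular_space_btop])
    (rule open_if_openin_btop)

lemma continuous_map_btop_wnorm: "continuous_map (btop P) euclideanreal (\<lambda>s. wnorm (s - z))"
proof -
  have "continuous_map (btop P) euclideanreal (\<lambda>s. dist (f s) w)" if "f \<in> gens P" for f w
    using continuous_map_initial[OF that] continuous_map_compose[of "btop P" euclidean f euclidean "\<lambda>v. dist v w"]
    by (auto simp: btop_def o_def continuous_on_dist intro: continuous_intros)
  then show ?thesis
    unfolding wnorm_diff by (intro continuous_map_add) (simp_all add: gens_def)
qed

lemma openin_btop_ball: "openin (btop P) {s. wnorm (s - z) < d}"
  using openin_continuous_map_preimage[OF continuous_map_btop_wnorm[of P z], of "{..<d}"]
  by simp

lemma openin_btop_bumpsum: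
  assumes "(x, X) \<in> P" shows "openin (btop P) {s. bumpsum X (s - x) < d}"
proof -
  let ?f = "\<lambda>t. complex_of_real (bumpsum X (t - x))"
  have "?f \<in> gens P" using assms by (force simp: gens_def)
  moreover have "open {w::complex. Re w < d}" by (intro open_Collect_less continuous_intros)
  ultimately have "openin (btop P) (?f -` {w. Re w < d})"
    unfolding btop_def by (rule openin_initial_vimage)
  then show ?thesis by (simp add: vimage_def)
qed

text \<open>Only the bump sets attached to \<open>z\<close> itself enter, because the other
  generators are winding-continuous at \<open>z\<close>. An upper bound on the bump sums suffices,
  as they are nonnegative and vanish at \<open>z\<close>.\<close>

definition nbd :: "(real \<times> nat set) set \<Rightarrow> real \<Rightarrow> real set \<Rightarrow> bool" where
  "nbd P z S \<longleftrightarrow> (\<exists>d>0. \<exists>F. finite F \<and> (\<forall>X\<in>F. (z, X) \<in> P) \<and>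
     (\<forall>s. wnorm (s - z) < d \<longrightarrow> (\<forall>X\<in>F. bumpsum X (s - z) < d) \<longrightarrow> s \<in> S))"

lemma nbdI:
  assumes "0 < d" "finite F" "\<And>X. X \<in> F \<Longrightarrow> (z, X) \<in> P"
    "\<And>s. wnorm (s - z) < d \<Longrightarrow> (\<And>X. X \<in> F \<Longrightarrow> bumpsum X (s - z) < d) \<Longrightarrow> s \<in> S"
  shows "nbd P z S"
  unfolding nbd_def using assms by (intro exI[of _ d] exI[of _ F] conjI) auto

lemma nbdE:
  assumes "nbd P z S"
  obtains d F where "0 < d" "finite F" "\<forall>X\<in>F. (z, X) \<in> P"
    "\<forall>s. wnorm (s - z) < d \<longrightarrow> (\<forall>X\<in>F. bumpsum X (s - z) < d) \<longrightarrow> s \<in> S"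
  using assms unfolding nbd_def by (elim exE conjE) (rule that)

lemma nbd_mono: "nbd P z S \<Longrightarrow> S \<subseteq> T \<Longrightarrow> nbd P z T"
  unfolding nbd_def by (meson subsetD)

lemma nbd_Int:
  assumes "nbd P z S" "nbd P z T" shows "nbd P z (S \<inter> T)"
proof -
  obtain d F where d: "0 < d" "finite F" "\<forall>X\<in>F. (z, X) \<in> P"
    "\<forall>s. wnorm (s - z) < d \<longrightarrow> (\<forall>X\<in>F. bumpsum X (s - z) < d) \<longrightarrow> s \<in> S"
    by (rule nbdE[OF assms(1)]) (rule that)
  obtain e G where e: "0 < e" "finite G" "\<forall>X\<in>G. (z, X) \<in> P"
    "\<forall>s. wnorm (s - z) < e \<longrightarrow> (\<forall>X\<in>G. bumpsum X (s - z) < e) \<longrightarrow> s \<in> T"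
    by (rule nbdE[OF assms(2)]) (rule that)
  show ?thesis
  proof (rule nbdI[of "min d e" "F \<union> G"])
    show "s \<in> S \<inter> T" if "wnorm (s - z) < min d e" "\<And>X. X \<in> F \<union> G \<Longrightarrow> bumpsum X (s - z) < min d e" for s
      using that d(4)[rule_format, of s] e(4)[rule_format, of s] by simp
  qed (use d e in auto)
qed

lemma nbd_INT:
  assumes "finite A" "\<And>a. a \<in> A \<Longrightarrow> nbd P z (S a)" shows "nbd P z (\<Inter>a\<in>A. S a)"
  using assms
proof (induction A rule: finite_induct)
  case empty
  show ?case by (rule nbdI[of 1 "{}"]) auto
next
  case (insert a A)
  then show ?case by (simp add: nbd_Int)
qed

text \<open>The two \<open>cis\<close> generators are controlled by \<open>wnorm\<close> alone. A
  bump generator based at \<open>z\<close> is one of the constraints allowed in \<open>nbd\<close>;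
  one based elsewhere is handled by \<open>bumpsum_wnorm_continuous\<close>.\<close>

lemma nbd_gens:
  assumes "f \<in> gens P" "0 < e" shows "nbd P z {s. dist (f s) (f z) < e}"
proof -
  consider "f = cis" | "f = (\<lambda>t. cis (sqrt 2 * t))"
    | x X where "(x, X) \<in> P" "f = (\<lambda>t. of_real (bumpsum X (t - x)))"
    using assms(1) by (auto simp: gens_def)
  then show ?thesis
  proof cases
    case 1
    show ?thesis by (rule nbdI[of e "{}"]) (use assms(2) 1 in \<open>auto simp: wnorm_diff intro: le_less_trans[rotated]\<close>)
  next
    case 2
    show ?thesis by (rule nbdI[of e "{}"]) (use assms(2) 2 in \<open>auto simp: wnorm_diff intro: le_less_trans[rotated]\<close>)
  next
    case 3
    have d: "dist (f s) (f z) = \<bar>bumpsum X (s - x) - bumpsum X (z - x)\<bar>" for s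
      unfolding 3(2) dist_norm by (simp flip: of_real_diff)
    show ?thesis
    proof (cases "z = x")
      case True
      show ?thesis
      proof (rule nbdI[of e "{X}"])
        show "s \<in> {s. dist (f s) (f z) < e}" if "\<And>Y. Y \<in> {X} \<Longrightarrow> bumpsum Y (s - z) < e" for s
          using that[of X] True bumpsum_nonneg[of X "s - x"] d[of s] by (simp add: bumpsum_near_0)
      qed (use assms(2) 3(1) True in auto)
    next
      case False
      then have "z - x \<noteq> 0" by simp
      then obtain \<delta> where \<delta>: "0 < \<delta>"
        "\<And>s. wnorm (s - (z - x)) < \<delta> \<Longrightarrow> \<bar>bumpsum X s - bumpsum X (z - x)\<bar> < e"
        using bumpsum_wnorm_continuous[OF _ assms(2)] by metis
      show ?thesis
      proof (rule nbdI[of \<delta> "{}"])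
        show "s \<in> {s. dist (f s) (f z) < e}" if "wnorm (s - z) < \<delta>" for s
          using \<delta>(2)[of "s - x"] that by (simp add: d)
      qed (use \<delta>(1) in auto)
    qed
  qed
qed

lemma openin_btop_nbd:
  assumes U: "openin (btop P) U" and z: "z \<in> U" shows "nbd P z U"
proof -
  obtain e F where e: "e > 0" and F: "finite F" "F \<subseteq> gens P"
    and FU: "{y. \<forall>f\<in>F. dist (f y) (f z) < e} \<subseteq> U"
    by (rule openin_initial_topologyE[OF U[unfolded btop_def] z]) (rule that)
  have "nbd P z (\<Inter>f\<in>F. {y. dist (f y) (f z) < e})"
    using F e by (intro nbd_INT nbd_gens) auto
  moreover have "(\<Inter>f\<in>F. {y. dist (f y) (f z) < e}) \<subseteq> U" using FU by auto
  ultimately show ?thesis by (rule nbd_mono)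
qed

lemma openin_btop_regular_point:
  assumes "openin (btop P) U" "z \<in> U" "z \<notin> fst ` P"
  obtains d where "0 < d" "\<And>s. wnorm (s - z) < d \<Longrightarrow> s \<in> U"
proof -
  obtain d F where d: "0 < d" "finite F" "\<forall>X\<in>F. (z, X) \<in> P"
    "\<forall>s. wnorm (s - z) < d \<longrightarrow> (\<forall>X\<in>F. bumpsum X (s - z) < d) \<longrightarrow> s \<in> U"
    by (rule nbdE[OF openin_btop_nbd[OF assms(1,2)]]) (rule that)
  have "F = {}" using d(3) assms(3) by force
  with d(4) show ?thesis by (intro that[OF d(1)]) simp
qed

text \<open>A nonempty open set is Euclidean open, hence uncountable, and so contains a point
  carrying no bumps. Around that point it contains a \<open>wnorm\<close> ball, which is unbounded
  by recurrence.\<close>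

lemma openin_btop_unbounded:
  assumes cnt: "countable (fst ` P)" and U: "openin (btop P) U" "U \<noteq> {}"
  shows "\<not> bounded U"
proof
  assume "bounded U"
  then obtain M where M: "\<And>x. x \<in> U \<Longrightarrow> \<bar>x\<bar> \<le> M" by (auto simp: bounded_iff)
  obtain x where "x \<in> U" using U(2) by auto
  then obtain e where e: "0 < e" "ball x e \<subseteq> U" using open_if_openin_btop[OF U(1)] openE by metis
  have "uncountable (ball x e)" using e(1) by (simp add: uncountable_ball)
  then obtain z where z: "z \<in> ball x e" "z \<notin> fst ` P"
    using cnt countable_subset[of "ball x e" "fst ` P"] by blast
  then obtain d where d: "0 < d" "\<And>s. wnorm (s - z) < d \<Longrightarrow> s \<in> U"
    using openin_btop_regular_point[OF U(1)] e(2) by (metis subsetD)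
  obtain t where "M - z < t" "wnorm t < d" using wnorm_recurrent[OF d(1)] by metis
  then show False using d(2)[of "z + t"] M[of "z + t"] by simp
qed

lemma first_category_btop: "countable (fst ` P) \<Longrightarrow> first_category (btop P)"
  by (rule first_category_coarse[OF topspace_btop Hausdorff_space_btop])
    (rule open_if_openin_btop, assumption, rule openin_btop_unbounded)

lemma btop_in_L_family: "btop P \<in> L_family"
  by (simp add: L_family_def Hausdorff_space_btop open_if_openin_btop)

lemma exists_separating_bump:
  assumes "infinite X" "finite F" "\<And>Y. Y \<in> F \<Longrightarrow> finite (X \<inter> Y)" "0 < d"
  obtains t where "wnorm t < d" "bumpsum X t = 1" "\<And>Y. Y \<in> F \<Longrightarrow> bumpsum Y t = 0"
proof -
  obtain m where m: "\<And>k. m \<le> k \<Longrightarrow> wnorm (c k) < d" using wnorm_c_small[OF assms(4)] by metis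
  have "finite (\<Union>Y\<in>F. X \<inter> Y)" using assms(2,3) by (rule finite_UN_I)
  then have "infinite (X - (\<Union>Y\<in>F. X \<inter> Y) - {..<m})" using assms(1) by (simp add: Diff_infinite_finite)
  then obtain k where k: "k \<in> X - (\<Union>Y\<in>F. X \<inter> Y) - {..<m}"
    using infinite_imp_nonempty by blast
  show ?thesis
  proof (rule that[of "c k"])
    show "wnorm (c k) < d" using k m by simp
    show "bumpsum X (c k) = 1" using k by (simp add: bumpsum_center)
    show "bumpsum Y (c k) = 0" if "Y \<in> F" for Y using k that by (auto simp: bumpsum_center)
  qed
qed

text \<open>\<open>F\<close> consists of the finitely many bump sets that control \<open>S\<close>.
  If \<open>X\<close> met each of them in a finite set only, some centre \<open>c k\<close> with
  \<open>k \<in> X\<close> would satisfy all constraints, although \<open>bumpsum X\<close> equals 1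
  there.\<close>

lemma nbd_bumpsum_finite:
  assumes "nbd P x S"
  obtains F where "finite F" "\<And>X. X \<in> F \<Longrightarrow> (x, X) \<in> P"
    "\<And>X. infinite X \<Longrightarrow> S \<subseteq> {s. bumpsum X (s - x) < 1} \<Longrightarrow> \<exists>Y\<in>F. infinite (X \<inter> Y)"
proof -
  obtain d F where d: "0 < d" "finite F" "\<forall>X\<in>F. (x, X) \<in> P"
    "\<forall>s. wnorm (s - x) < d \<longrightarrow> (\<forall>X\<in>F. bumpsum X (s - x) < d) \<longrightarrow> s \<in> S"
    by (rule nbdE[OF assms]) (rule that)
  have "\<exists>Y\<in>F. infinite (X \<inter> Y)" if X: "infinite X" and S: "S \<subseteq> {s. bumpsum X (s - x) < 1}" for X
  proof (rule ccontr)
    assume "\<not> ?thesis"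
    then have "\<And>Y. Y \<in> F \<Longrightarrow> finite (X \<inter> Y)" by blast
    then obtain t where t: "wnorm t < d" "bumpsum X t = 1" "\<And>Y. Y \<in> F \<Longrightarrow> bumpsum Y t = 0"
      using exists_separating_bump[OF X d(2) _ d(1)] by metis
    have "x + t \<in> S" using d(4)[rule_format, of "x + t"] t d(1) by simp
    then have "x + t \<in> {s. bumpsum X (s - x) < 1}" using S by blast
    then show False using t(2) by simp
  qed
  with d(2,3) show ?thesis by (intro that[of F]) auto
qed

lemma gens_lepoll:
  assumes "infinite K" "P \<lesssim> K" shows "gens P \<lesssim> K"
  unfolding gens_def
proof (rule Un_lepoll_infinite[OF assms(1)])
  show "{cis, \<lambda>t. cis (sqrt 2 * t)} \<lesssim> K" by (rule nat_lepoll_infinite[OF assms(1)]) simp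
  show "(\<lambda>(x, X) t. complex_of_real (bumpsum X (t - x))) ` P \<lesssim> K"
    using image_lepoll assms(2) by (rule lepoll_trans)
qed

section \<open>Weight, and recovery of the bump sets from the topology\<close>

definition almost_disjoint :: "nat set set \<Rightarrow> bool" where
  "almost_disjoint \<A> \<longleftrightarrow> (\<forall>X\<in>\<A>. infinite X) \<and> (\<forall>X\<in>\<A>. \<forall>Y\<in>\<A>. X \<noteq> Y \<longrightarrow> finite (X \<inter> Y))"

text \<open>The upper bound counts basic balls. For the lower bound, assign to each \<open>X\<close>
  attached to \<open>x\<close> a base member around \<open>x\<close> inside
  \<open>{s. bumpsum X (s - x) < 1}\<close>; by almost disjointness one base member serves only
  finitely many \<open>X\<close>.\<close>

lemma has_weight_btop:
  assumes inf: "infinite K" and P: "P \<lesssim> K"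
    and A: "almost_disjoint {X. (x, X) \<in> P}" and AK: "{X. (x, X) \<in> P} \<approx> K"
  shows "has_weight (btop P) K"
proof -
  let ?A = "{X. (x, X) \<in> P}"
  have lower: "K \<lesssim> B" if B: "is_base_of B (btop P)" for B
  proof -
    have "\<exists>b\<in>B. x \<in> b \<and> b \<subseteq> {s. bumpsum X (s - x) < 1}" if "X \<in> ?A" for X
    proof -
      have "openin (btop P) {s. bumpsum X (s - x) < 1}" using that by (intro openin_btop_bumpsum) simp
      then obtain C where C: "C \<subseteq> B" "\<Union>C = {s. bumpsum X (s - x) < 1}"
        using B by (auto simp: is_base_of_def)
      have "x \<in> \<Union>C" unfolding C(2) by (simp add: bumpsum_near_0)
      then obtain b where "b \<in> C" "x \<in> b" by blast
      then show ?thesis using C by (intro bexI[of _ b]) auto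
    qed
    then obtain b where b: "\<And>X. X \<in> ?A \<Longrightarrow> b X \<in> B \<and> x \<in> b X \<and> b X \<subseteq> {s. bumpsum X (s - x) < 1}"
      by metis
    have "?A \<lesssim> B"
    proof (rule finite_to_one_lepoll)
      show "infinite ?A" using eqpoll_finite_iff[OF AK] inf by simp
      show "b ` ?A \<subseteq> B" using b by auto
      fix V assume V: "V \<in> B"
      show "finite {X \<in> ?A. b X = V}"
      proof (cases "x \<in> V")
        case True
        have "openin (btop P) V" using B V by (simp add: is_base_of_def)
        then have "nbd P x V" using True by (rule openin_btop_nbd)
        then obtain F where F: "finite F" "\<And>X. X \<in> F \<Longrightarrow> (x, X) \<in> P"
          "\<And>X. infinite X \<Longrightarrow> V \<subseteq> {s. bumpsum X (s - x) < 1} \<Longrightarrow> \<exists>Y\<in>F. infinite (X \<inter> Y)"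
          using nbd_bumpsum_finite by metis
        have "{X \<in> ?A. b X = V} \<subseteq> F"
        proof
          fix X assume X: "X \<in> {X \<in> ?A. b X = V}"
          then have "infinite X" "V \<subseteq> {s. bumpsum X (s - x) < 1}"
            using A b[of X] by (auto simp: almost_disjoint_def)
          then obtain Y where Y: "Y \<in> F" "infinite (X \<inter> Y)" using F(3) by blast
          then have "X = Y" using A X F(2) by (auto simp: almost_disjoint_def)
          then show "X \<in> F" using Y(1) by simp
        qed
        then show ?thesis using F(1) finite_subset by blast
      next
        case False
        then have "{X \<in> ?A. b X = V} = {}" using b by blast
        then show ?thesis by (simp only: finite.emptyI)
      qed
    qed
    then show ?thesis by (rule lepoll_trans1[OF eqpoll_sym[OF AK]])
  qed
  obtain B where B: "is_base_of B (btop P)" "B \<lesssim> K"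
    by (rule initial_topology_base_lepoll[OF continuous_gens[of _ P] inf gens_lepoll[OF inf P],
          folded btop_def]) (assumption, rule that)
  then have "B \<approx> K" using lower by (intro lepoll_antisym)
  then show ?thesis unfolding has_weight_def using B(1) lower by auto
qed

text \<open>The set \<open>{s. bumpsum X (s - x) < 1}\<close> is open in both topologies, so
  \<open>Q\<close> must attach to \<open>x\<close> some set meeting \<open>X\<close> infinitely
  often; by \<open>fin\<close> this can only be \<open>X\<close>.\<close>

lemma btop_determines_bumps:
  assumes eq: "btop P = btop Q" and X: "(x, X) \<in> P" "infinite X"
    and fin: "\<And>Y. (x, Y) \<in> Q \<Longrightarrow> Y \<noteq> X \<Longrightarrow> finite (X \<inter> Y)"
  shows "(x, X) \<in> Q"
proof -
  have "openin (btop Q) {s. bumpsum X (s - x) < 1}"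
    using openin_btop_bumpsum[OF X(1)] by (simp flip: eq)
  then have "nbd Q x {s. bumpsum X (s - x) < 1}" by (rule openin_btop_nbd) (simp add: bumpsum_near_0)
  then obtain F where F: "\<And>Y. Y \<in> F \<Longrightarrow> (x, Y) \<in> Q"
    "\<And>Y. infinite Y \<Longrightarrow> {s. bumpsum X (s - x) < 1} \<subseteq> {s. bumpsum Y (s - x) < 1} \<Longrightarrow> \<exists>Z\<in>F. infinite (Y \<inter> Z)"
    using nbd_bumpsum_finite by metis
  obtain Y where Y: "Y \<in> F" "infinite (X \<inter> Y)" using F(2)[OF X(2) order_refl] by blast
  then show ?thesis using F(1)[OF Y(1)] fin[of Y] by blast
qed

end

section \<open>Flow points\<close>

text \<open>At a flow point, all points close to \<open>x\<close> can be carried along the line, inside a given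
  neighbourhood of \<open>x\<close>, to points close to some fixed \<open>z \<noteq> x\<close>.\<close>

definition flow_point :: "real topology \<Rightarrow> real \<Rightarrow> bool" where
  "flow_point X x \<longleftrightarrow> (\<forall>U. openin X U \<longrightarrow> x \<in> U \<longrightarrow> (\<exists>z. z \<noteq> x \<and> (\<forall>W. openin X W \<longrightarrow> z \<in> W \<longrightarrow>
     (\<exists>V. openin X V \<and> x \<in> V \<and> (\<forall>y\<in>V. \<exists>C. connected C \<and> C \<subseteq> U \<and> y \<in> C \<and> C \<inter> W \<noteq> {})))))"

lemma homeomorphic_maps_UNIV:
  assumes "homeomorphic_maps X Y f g" "topspace X = UNIV" "topspace Y = UNIV"
  shows "g (f x) = x" "f (g y) = y" "openin Y V \<Longrightarrow> openin X (f -` V)" "openin X U \<Longrightarrow> openin Y (g -` U)"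
  using assms by (simp_all add: homeomorphic_maps_def continuous_map_def vimage_def)

text \<open>The sets \<open>C\<close> in \<open>flow_point\<close> are connected in the Euclidean
  sense, so carrying them back calls for Euclidean continuity of \<open>g\<close> besides the
  homeomorphism.\<close>

lemma flow_point_homeomorphic_maps:
  assumes hom: "homeomorphic_maps X Y f g" and top: "topspace X = UNIV" "topspace Y = UNIV"
    and cont: "continuous_on UNIV g" and flow: "flow_point Y (f x)"
  shows "flow_point X x"
  unfolding flow_point_def
proof (intro allI impI)
  note h = homeomorphic_maps_UNIV[OF hom top]
  fix U assume U: "openin X U" "x \<in> U"
  have "openin Y (g -` U)" "f x \<in> g -` U" using h U by auto
  from flow[unfolded flow_point_def, rule_format, OF this] obtain z where z: "z \<noteq> f x" and
    zW: "\<forall>W. openin Y W \<longrightarrow> z \<in> W \<longrightarrow> (\<exists>V. openin Y V \<and> f x \<in> V \<and>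
      (\<forall>y\<in>V. \<exists>C. connected C \<and> C \<subseteq> g -` U \<and> y \<in> C \<and> C \<inter> W \<noteq> {}))"
    by (elim exE conjE) (rule that)
  show "\<exists>z. z \<noteq> x \<and> (\<forall>W. openin X W \<longrightarrow> z \<in> W \<longrightarrow>
     (\<exists>V. openin X V \<and> x \<in> V \<and> (\<forall>y\<in>V. \<exists>C. connected C \<and> C \<subseteq> U \<and> y \<in> C \<and> C \<inter> W \<noteq> {})))"
  proof (intro exI[of _ "g z"] conjI allI impI)
    show "g z \<noteq> x" using z h(2)[of z] by auto
    fix W assume W: "openin X W" "g z \<in> W"
    have "openin Y (g -` W)" "z \<in> g -` W" using h W by auto
    from zW[rule_format, OF this] obtain V where V: "openin Y V" "f x \<in> V" and
      VC: "\<forall>y\<in>V. \<exists>C. connected C \<and> C \<subseteq> g -` U \<and> y \<in> C \<and> C \<inter> g -` W \<noteq> {}"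
      by (elim exE conjE) (rule that)
    show "\<exists>V. openin X V \<and> x \<in> V \<and> (\<forall>y\<in>V. \<exists>C. connected C \<and> C \<subseteq> U \<and> y \<in> C \<and> C \<inter> W \<noteq> {})"
    proof (rule exI[of _ "f -` V"], intro conjI ballI)
      show "openin X (f -` V)" "x \<in> f -` V" using h V by auto
      fix y assume "y \<in> f -` V"
      then have "f y \<in> V" by simp
      from bspec[OF VC this] obtain C where C: "connected C" "C \<subseteq> g -` U" "f y \<in> C" "C \<inter> g -` W \<noteq> {}"
        by (elim exE conjE) (rule that)
      show "\<exists>C. connected C \<and> C \<subseteq> U \<and> y \<in> C \<and> C \<inter> W \<noteq> {}"
      proof (intro exI[of _ "g ` C"] conjI)
        show "connected (g ` C)"
          using C(1) continuous_on_subset[OF cont subset_UNIV] by (rule connected_continuous_image[rotated])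
        show "g ` C \<subseteq> U" "g ` C \<inter> W \<noteq> {}" using C(2,4) by auto
        show "y \<in> g ` C" using h(1)[of y] C(3) by (metis imageI)
      qed
    qed
  qed
qed

lemma flow_point_homeomorphic_maps_iff:
  assumes "homeomorphic_maps X Y f g" "topspace X = UNIV" "topspace Y = UNIV"
    and "continuous_on UNIV f" "continuous_on UNIV g"
  shows "flow_point Y (f x) \<longleftrightarrow> flow_point X x"
proof
  show "flow_point X x" if "flow_point Y (f x)"
    using flow_point_homeomorphic_maps[OF assms(1-3,5) that] .
  assume "flow_point X x"
  then have "flow_point X (g (f x))" using homeomorphic_maps_UNIV(1)[OF assms(1-3)] by simp
  then show "flow_point Y (f x)"
    by (rule flow_point_homeomorphic_maps[OF homeomorphic_maps_sym[THEN iffD1, OF assms(1)] assms(3,2,4)])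
qed

context bumps
begin

text \<open>Take \<open>z\<close> slightly to the right of \<open>x\<close>, both without bumps. The
  segment from \<open>y\<close> to \<open>y + (z - x)\<close> moves parallel to that from
  \<open>x\<close> to \<open>z\<close>, because the winding metric is translation invariant.\<close>

lemma flow_point_btop:
  assumes cnt: "countable (fst ` P)" and x: "x \<notin> fst ` P"
  shows "flow_point (btop P) x"
  unfolding flow_point_def
proof (intro allI impI)
  fix U assume "openin (btop P) U" "x \<in> U"
  then obtain d where d: "0 < d" "\<And>s. wnorm (s - x) < d \<Longrightarrow> s \<in> U"
    using openin_btop_regular_point[OF _ _ x] by metis
  have "isCont wnorm 0"
    using continuous_on_wnorm[OF continuous_on_id, of UNIV] by (simp add: continuous_on_eq_continuous_at)
  from iffD1[OF continuous_at_eps_delta this, rule_format, of "d/2"] d(1)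
  obtain e where e: "0 < e" "\<And>s. \<bar>s\<bar> < e \<Longrightarrow> wnorm s < d/2"
    by (auto simp: dist_real_def)
  \<comment> \<open>Countability of the bump points lets \<open>z\<close> avoid them, so that
    neighbourhoods of \<open>z\<close> contain \<open>wnorm\<close> balls.\<close>
  have "uncountable {x<..<x+e}" using e(1) by (simp add: uncountable_open_interval)
  then have "\<not> {x<..<x+e} \<subseteq> fst ` P" using countable_subset[OF _ cnt] by blast
  then obtain z where "z \<in> {x<..<x+e}" and zP: "z \<notin> fst ` P" by blast
  then have z: "x < z" "z < x + e" "z \<notin> fst ` P" by auto
  show "\<exists>z. z \<noteq> x \<and> (\<forall>W. openin (btop P) W \<longrightarrow> z \<in> W \<longrightarrow> (\<exists>V. openin (btop P) V \<and> x \<in> V \<and>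
      (\<forall>y\<in>V. \<exists>C. connected C \<and> C \<subseteq> U \<and> y \<in> C \<and> C \<inter> W \<noteq> {})))"
  proof (intro exI[of _ z] conjI allI impI)
    fix W assume "openin (btop P) W" "z \<in> W"
    then obtain b where b: "0 < b" "\<And>s. wnorm (s - z) < b \<Longrightarrow> s \<in> W"
      using openin_btop_regular_point[OF _ _ z(3)] by metis
    show "\<exists>V. openin (btop P) V \<and> x \<in> V \<and> (\<forall>y\<in>V. \<exists>C. connected C \<and> C \<subseteq> U \<and> y \<in> C \<and> C \<inter> W \<noteq> {})"
    proof (rule exI[of _ "{s. wnorm (s - x) < min b (d/2)}"], intro conjI ballI openin_btop_ball)
      show "x \<in> {s. wnorm (s - x) < min b (d/2)}" using b(1) d(1) by simp
      fix y assume y: "y \<in> {s. wnorm (s - x) < min b (d/2)}"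
      show "\<exists>C. connected C \<and> C \<subseteq> U \<and> y \<in> C \<and> C \<inter> W \<noteq> {}"
      proof (intro exI[of _ "{y..y + (z - x)}"] conjI)
        show "{y..y + (z - x)} \<subseteq> U"
        proof
          fix s assume s: "s \<in> {y..y + (z - x)}"
          then have "wnorm (s - y) < d/2" using e(2)[of "s - y"] z by auto
          then have "wnorm (s - x) < d" using wnorm_diff_triangle[of s x y] y by simp
          then show "s \<in> U" by (rule d(2))
        qed
        have "y + (z - x) \<in> W" using y by (intro b(2)) simp
        moreover have "y + (z - x) \<in> {y..y + (z - x)}" using z(1) by simp
        ultimately show "{y..y + (z - x)} \<inter> W \<noteq> {}" by blast
      qed (use z(1) in auto)
    qed
  qed (use z(1) in simp)
qed

text \<open>A point near \<open>x\<close> just in front of a bump centre \<open>x + c k\<close> cannot move past that centre, hence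
  never gets close to a given point \<open>z\<close> behind it; a bump centre can be approached from both sides.\<close>

lemma not_flow_point_btop:
  assumes P: "(x, UNIV) \<in> P" shows "\<not> flow_point (btop P) x"
proof
  \<comment> \<open>The first factor removes all centres \<open>x + c k\<close>; the second is too
    small for a connected subset to contain two points at Euclidean distance 1.\<close>
  let ?U = "{s. bumpsum UNIV (s - x) < 1} \<inter> {s. wnorm (s - x) < wnorm 1 / 2}"
  assume flow: "flow_point (btop P) x"
  have "openin (btop P) ?U" by (intro openin_Int openin_btop_bumpsum[OF P] openin_btop_ball)
  moreover have "x \<in> ?U" using wnorm_pos[of 1] by (simp add: bumpsum_near_0)
  ultimately have "\<exists>z. z \<noteq> x \<and> (\<forall>W. openin (btop P) W \<longrightarrow> z \<in> W \<longrightarrow>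
      (\<exists>V. openin (btop P) V \<and> x \<in> V \<and> (\<forall>y\<in>V. \<exists>C. connected C \<and> C \<subseteq> ?U \<and> y \<in> C \<and> C \<inter> W \<noteq> {})))"
    by (rule flow[unfolded flow_point_def, rule_format])
  then obtain z where z: "z \<noteq> x" and zW: "\<forall>W. openin (btop P) W \<longrightarrow> z \<in> W \<longrightarrow>
      (\<exists>V. openin (btop P) V \<and> x \<in> V \<and> (\<forall>y\<in>V. \<exists>C. connected C \<and> C \<subseteq> ?U \<and> y \<in> C \<and> C \<inter> W \<noteq> {}))"
    by (elim exE conjE) (rule that)
  have "0 < \<bar>z - x\<bar>" using z by simp
  \<comment> \<open>The margin 2 covers the length \<open>h \<le> 1\<close> from \<open>y\<close> to
    the centre plus the distance below 1 from \<open>y\<close> to the end point \<open>w\<close>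
    found later.\<close>
  then obtain b where b: "0 < b" "\<And>s. \<bar>z - x\<bar> \<le> s \<Longrightarrow> s \<le> \<bar>z - x\<bar> + 2 \<Longrightarrow> b \<le> wnorm s"
    using wnorm_segment_bound[of "\<bar>z - x\<bar>" "\<bar>z - x\<bar> + 2"] by metis
  let ?W = "{s. wnorm (s - z) < b/2}"
  have "openin (btop P) ?W" by (rule openin_btop_ball)
  moreover have "z \<in> ?W" using b(1) by simp
  ultimately have "\<exists>V. openin (btop P) V \<and> x \<in> V \<and>
      (\<forall>y\<in>V. \<exists>C. connected C \<and> C \<subseteq> ?U \<and> y \<in> C \<and> C \<inter> ?W \<noteq> {})"
    by (rule zW[rule_format])
  then obtain V where V: "openin (btop P) V" "x \<in> V" and
    VC: "\<forall>y\<in>V. \<exists>C. connected C \<and> C \<subseteq> ?U \<and> y \<in> C \<and> C \<inter> ?W \<noteq> {}"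
    by (elim exE conjE) (rule that)
  obtain d F where d: "0 < d" "finite F" "\<forall>X\<in>F. (x, X) \<in> P"
    "\<forall>s. wnorm (s - x) < d \<longrightarrow> (\<forall>X\<in>F. bumpsum X (s - x) < d) \<longrightarrow> s \<in> V"
    by (rule nbdE[OF openin_btop_nbd[OF V]]) (rule that)
  have "0 < min d b / 2" using d(1) b(1) by simp
  then obtain k where k: "wnorm (c k) < min d b / 2" using wnorm_c_small by blast
  obtain h where h: "0 < h" "h \<le> 1"
    "\<And>t X. t = c k - h \<or> t = c k + h \<Longrightarrow> bumpsum X t = 0 \<and> wnorm t < 2 * wnorm (c k)"
    using bump_boundary[of k] by metis
  \<comment> \<open>\<open>y\<close> lies on the edge of the bump, on the side of the centre
    opposite to the direction from \<open>x\<close> to \<open>z\<close>.\<close>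
  define y where "y = (if x < z then x + (c k - h) else x + (c k + h))"
  have y: "bumpsum X (y - x) = 0 \<and> wnorm (y - x) < 2 * wnorm (c k)" for X
    using h(3)[of "y - x" X] by (simp add: y_def)
  have "wnorm (y - x) < d" using y[of UNIV] k by simp
  moreover have "\<forall>X\<in>F. bumpsum X (y - x) < d" using y d(1) by simp
  ultimately have "y \<in> V" using d(4) by blast
  from bspec[OF VC this] obtain C where C: "connected C" "C \<subseteq> ?U" "y \<in> C" "C \<inter> ?W \<noteq> {}"
    by (elim exE conjE) (rule that)
  then obtain w where w: "w \<in> C" "wnorm (w - z) < b/2" by auto
  have interval: "s \<in> C" if "y \<le> s \<and> s \<le> w \<or> w \<le> s \<and> s \<le> y" for s
    using that connectedD_interval[OF C(1)] C(3) w(1) by metis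
  have small: "wnorm (s - t) < wnorm 1" if "s \<in> C" "t \<in> C" for s t
  proof -
    have "wnorm (s - x) < wnorm 1 / 2" "wnorm (t - x) < wnorm 1 / 2" using that C(2) by auto
    then show ?thesis using wnorm_diff_triangle[of s t x] by (simp add: wnorm_minus_commute[of x t])
  qed
  have "y - 1 \<notin> C" "y + 1 \<notin> C" using small[of "y - 1" y] small[of "y + 1" y] C(3) by auto
  then have near: "\<bar>w - y\<bar> < 1" using interval[of "y - 1"] interval[of "y + 1"] by fastforce
  have "x + c k \<notin> C" using C(2) by (auto simp: bumpsum_center)
  then have block: "\<not> (y \<le> x + c k \<and> x + c k \<le> w)" "\<not> (w \<le> x + c k \<and> x + c k \<le> y)"
    using interval by blast+
  have "b \<le> wnorm (\<bar>z - x\<bar> + \<bar>x + c k - w\<bar>)"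
    using near h(1,2) by (intro b(2)) (auto simp: y_def split: if_splits)
  \<comment> \<open>Since \<open>w\<close> is still on the same side of the centre as
    \<open>y\<close>, the two absolute values carry the same sign and add up to a number that is
    small for \<open>wnorm\<close>, contradicting the choice of \<open>b\<close>.\<close>
  also have "\<bar>z - x\<bar> + \<bar>x + c k - w\<bar> = (if x < z then (z - w) + c k else - ((z - w) + c k))"
    using block h(1) z by (auto simp: y_def)
  also have "wnorm \<dots> = wnorm ((z - w) + c k)" by (simp del: minus_add_distrib)
  also have "\<dots> \<le> wnorm (z - w) + wnorm (c k)" by (rule wnorm_triangle)
  also have "\<dots> < b" using w(2) k by (simp add: wnorm_minus_commute[of z w])
  finally show False by simp
qed

section \<open>Homeomorphisms between bump topologies\<close>

lemma homeomorphic_maps_btop_continuous: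
  assumes "homeomorphic_maps (btop P) (btop Q) f g"
  shows "continuous_on UNIV f" "continuous_on UNIV g"
proof -
  have "continuous_on UNIV f" if f: "continuous_map (btop P) (btop Q) f" for P Q f
  proof (rule continuous_on_if_winding_continuous)
    have "continuous_map (btop P) euclidean (h \<circ> f)" if "h \<in> gens Q" for h
      using f continuous_map_initial[OF that] unfolding btop_def by (rule continuous_map_compose)
    then have *: "continuous_on UNIV (h \<circ> f)" if "h \<in> gens Q" for h
      using that continuous_map_btopD by blast
    show "continuous_on UNIV (\<lambda>t. cis (f t))" using *[of cis] by (simp add: gens_def o_def)
    show "continuous_on UNIV (\<lambda>t. cis (sqrt 2 * f t))"
      using *[of "\<lambda>t. cis (sqrt 2 * t)"] by (simp add: gens_def o_def)
  qed
  then show "continuous_on UNIV f" "continuous_on UNIV g"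
    using assms by (auto simp: homeomorphic_maps_def)
qed

text \<open>A homeomorphism onto \<open>btop Q\<close> is determined by its values at the rationals, and it determines
  its domain.\<close>

lemma homeomorphic_class_lepoll:
  "{\<sigma> \<in> range btop. \<sigma> homeomorphic_space btop Q} \<lesssim> (UNIV :: nat set set)"
proof -
  let ?T = "{\<sigma> \<in> range btop. \<sigma> homeomorphic_space btop Q}"
  have "\<exists>f g. homeomorphic_maps \<sigma> (btop Q) f g \<and> continuous_on UNIV f" if s: "\<sigma> \<in> ?T" for \<sigma>
  proof -
    obtain P where P: "\<sigma> = btop P" using s by auto
    obtain f g where "homeomorphic_maps \<sigma> (btop Q) f g" using s by (auto simp: homeomorphic_space_def)
    then show ?thesis using homeomorphic_maps_btop_continuous(1)[of P Q f g] P by blast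
  qed
  then obtain f g where fg: "\<And>\<sigma>. \<sigma> \<in> ?T \<Longrightarrow> homeomorphic_maps \<sigma> (btop Q) (f \<sigma>) (g \<sigma>) \<and> continuous_on UNIV (f \<sigma>)"
    by metis
  \<comment> \<open>\<open>h\<close> records the Dedekind cuts of the values at rational points,
    which makes a homeomorphism into a set of pairs of rationals.\<close>
  define h where "h \<sigma> = {(p, q). real_of_rat p < f \<sigma> (real_of_rat q)}" for \<sigma>
  have "inj_on h ?T"
  proof (rule inj_onI)
    fix \<sigma> \<rho> assume s: "\<sigma> \<in> ?T" and r: "\<rho> \<in> ?T" and eq: "h \<sigma> = h \<rho>"
    have rat: "f \<sigma> (real_of_rat q) = f \<rho> (real_of_rat q)" for q
    proof -
      have iff: "real_of_rat p < f \<sigma> (real_of_rat q) \<longleftrightarrow> real_of_rat p < f \<rho> (real_of_rat q)" for p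
        using eq by (auto simp: h_def set_eq_iff)
      show ?thesis
      proof (rule antisym; rule ccontr)
        assume "\<not> f \<sigma> (real_of_rat q) \<le> f \<rho> (real_of_rat q)"
        then obtain p where "f \<rho> (real_of_rat q) < real_of_rat p" "real_of_rat p < f \<sigma> (real_of_rat q)"
          using of_rat_dense by (metis not_le)
        then show False using iff[of p] by simp
      next
        assume "\<not> f \<rho> (real_of_rat q) \<le> f \<sigma> (real_of_rat q)"
        then obtain p where "f \<sigma> (real_of_rat q) < real_of_rat p" "real_of_rat p < f \<rho> (real_of_rat q)"
          using of_rat_dense by (metis not_le)
        then show False using iff[of p] by simp
      qed
    qed
    have "f \<sigma> x = f \<rho> x" for x
    proof -
      have "f \<sigma> x - f \<rho> x = 0"
      proof (rule continuous_constant_on_closure[of \<rat> "\<lambda>x. f \<sigma> x - f \<rho> x"])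
        show "continuous_on (closure \<rat>) (\<lambda>x. f \<sigma> x - f \<rho> x)"
          using fg[OF s] fg[OF r] by (simp add: Rats_closure_real continuous_on_diff)
        show "f \<sigma> x - f \<rho> x = 0" if "x \<in> \<rat>" for x using that rat by (auto elim: Rats_cases)
      qed (simp add: Rats_closure_real)
      then show ?thesis by simp
    qed
    then have ff: "f \<sigma> = f \<rho>" by (rule ext)
    have top: "topspace \<tau> = UNIV" if "\<tau> \<in> ?T" for \<tau> using that by auto
    \<comment> \<open>The open sets of the domain are exactly those with open image, so equal maps
      force equal topologies.\<close>
    have op: "openin \<tau> U \<longleftrightarrow> openin (btop Q) (f \<tau> ` U)" if t: "\<tau> \<in> ?T" for \<tau> U
    proof -
      have "homeomorphic_map \<tau> (btop Q) (f \<tau>)" using fg[OF t] homeomorphic_maps_map by blast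
      then show ?thesis using homeomorphic_map_openness_eq[of \<tau> "btop Q" "f \<tau>" U] top[OF t] by auto
    qed
    show "\<sigma> = \<rho>" unfolding topology_eq using op[OF s] op[OF r] ff by simp
  qed
  then have "?T \<lesssim> (UNIV :: (rat \<times> rat) set set)" by (auto simp: lepoll_def)
  also have "\<dots> \<lesssim> (UNIV :: nat set set)"
    unfolding lepoll_def by (intro exI[of _ "(`) to_nat"]) (auto simp: inj_def inj_image_eq_iff)
  finally show ?thesis .
qed

end

section \<open>Coding sets of natural numbers by subsets of the line\<close>

definition lim_left :: "real set \<Rightarrow> real \<Rightarrow> bool" where
  "lim_left B x \<longleftrightarrow> (\<forall>a<x. \<exists>b\<in>B. a < b \<and> b < x)"

definition lim_right :: "real set \<Rightarrow> real \<Rightarrow> bool" where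
  "lim_right B x \<longleftrightarrow> (\<forall>a>x. \<exists>b\<in>B. x < b \<and> b < a)"

lemma lim_right_eq_lim_left: "lim_right B x \<longleftrightarrow> lim_left (uminus ` B) (- x)"
proof
  assume R: "lim_right B x"
  show "lim_left (uminus ` B) (- x)"
    unfolding lim_left_def
  proof (intro allI impI)
    fix a assume "a < - x"
    then have "x < - a" by simp
    then obtain b where "b \<in> B" "x < b" "b < - a" using R unfolding lim_right_def by blast
    then show "\<exists>b\<in>uminus ` B. a < b \<and> b < - x" by (intro bexI[of _ "- b"]) auto
  qed
next
  assume L: "lim_left (uminus ` B) (- x)"
  show "lim_right B x"
    unfolding lim_right_def
  proof (intro allI impI)
    fix a assume "x < a"
    then have "- a < - x" by simp
    then obtain b where "b \<in> B" "- a < - b" "- b < - x" using L unfolding lim_left_def by blast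
    then show "\<exists>b\<in>B. x < b \<and> b < a" by (intro bexI[of _ b]) auto
  qed
qed

lemma lim_left_eq_lim_right: "lim_left B x \<longleftrightarrow> lim_right (uminus ` B) (- x)"
  by (simp add: lim_right_eq_lim_left image_image)

lemma lim_left_strict_mono:
  assumes f: "strict_mono f" "surj f" shows "lim_left (f ` B) (f x) \<longleftrightarrow> lim_left B x"
proof
  assume L: "lim_left (f ` B) (f x)"
  show "lim_left B x"
    unfolding lim_left_def
  proof (intro allI impI)
    fix a assume "a < x"
    then have "f a < f x" using f(1) by (simp add: strict_mono_less)
    then obtain b where "b \<in> B" "f a < f b" "f b < f x" using L unfolding lim_left_def by blast
    then show "\<exists>b\<in>B. a < b \<and> b < x" using f(1) by (auto simp: strict_mono_less)
  qed
next
  assume L: "lim_left B x"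
  show "lim_left (f ` B) (f x)"
    unfolding lim_left_def
  proof (intro allI impI)
    fix a' assume a': "a' < f x"
    obtain a where a: "a' = f a" using f(2) by (metis surjD)
    then have "a < x" using a' f(1) by (simp add: strict_mono_less)
    then obtain b where "b \<in> B" "a < b" "b < x" using L unfolding lim_left_def by blast
    then show "\<exists>b\<in>f ` B. a' < b \<and> b < f x" using a f(1) by (auto simp: strict_mono_less)
  qed
qed

lemma surj_uminus_comp: "surj f \<Longrightarrow> surj (\<lambda>x. - f x)" for f :: "real \<Rightarrow> real"
  by (metis surj_def minus_minus)

lemma lim_right_strict_mono:
  assumes f: "strict_mono f" "surj f" shows "lim_right (f ` B) (f x) \<longleftrightarrow> lim_right B x"
proof -
  have "surj (\<lambda>x. - f (- x))"
    using f(2) by (metis surj_def minus_minus)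
  moreover have "strict_mono (\<lambda>x. - f (- x))" using f(1) by (simp add: strict_mono_def)
  ultimately show ?thesis
    using lim_left_strict_mono[of "\<lambda>x. - f (- x)" "uminus ` B" "- x"]
    by (simp add: lim_right_eq_lim_left image_image)
qed

lemma lim_left_strict_antimono:
  assumes f: "strict_antimono_on UNIV f" "surj f" shows "lim_right (f ` B) (f x) \<longleftrightarrow> lim_left B x"
  using lim_left_strict_mono[OF _ surj_uminus_comp[OF f(2)], of B x] f(1)
  by (simp add: lim_right_eq_lim_left image_image monotone_on_def)

lemma lim_right_strict_antimono:
  assumes f: "strict_antimono_on UNIV f" "surj f" shows "lim_left (f ` B) (f x) \<longleftrightarrow> lim_right B x"
  using lim_right_strict_mono[OF _ surj_uminus_comp[OF f(2)], of B x] f(1)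
  by (simp add: lim_left_eq_lim_right image_image monotone_on_def)

text \<open>One extra point is bypassed by starting beyond it. This makes the point
  \<open>- 1\<close> harmless, for which it stays undecided whether it is a flow point.\<close>

lemma lim_left_insert: "lim_left (insert p B) x \<longleftrightarrow> lim_left B x"
proof
  assume L: "lim_left (insert p B) x"
  show "lim_left B x"
    unfolding lim_left_def
  proof (intro allI impI)
    fix a assume "a < x"
    then have "(if p < x then max a p else a) < x" by simp
    then obtain b where "b \<in> insert p B" "(if p < x then max a p else a) < b" "b < x"
      using L unfolding lim_left_def by blast
    then show "\<exists>b\<in>B. a < b \<and> b < x" by (auto split: if_splits)
  qed
qed (auto simp: lim_left_def)

lemma lim_right_insert: "lim_right (insert p B) x \<longleftrightarrow> lim_right B x"
  by (simp add: lim_right_eq_lim_left lim_left_insert)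

text \<open>A sequence converges to \<open>n\<close> from the left for \<open>n \<in> S\<close> and
  from the right otherwise. The offset 3 keeps it within \<open>1/3\<close> of \<open>n\<close>, so
  different integers do not interfere; working in \<open>int\<close> makes the family closed under
  reflection.\<close>

definition int_marks :: "int set \<Rightarrow> int set \<Rightarrow> real set" where
  "int_marks I S = {of_int n + (if n \<in> S then - 1 else 1) / (real k + 3) | n k. n \<in> I}"

lemma uminus_int_marks: "uminus ` int_marks I S = int_marks (uminus ` I) (uminus ` (- S))"
proof -
  have eq: "- (of_int n + (if n \<in> S then - 1 else 1) / (real k + 3)) =
      of_int (- n) + (if - n \<in> uminus ` (- S) then - 1 else 1) / (real k + 3)" for n k
    by auto
  show ?thesis
  proof (intro subset_antisym subsetI)
    fix y assume "y \<in> uminus ` int_marks I S"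
    then obtain n k where "n \<in> I" "y = - (of_int n + (if n \<in> S then - 1 else 1) / (real k + 3))"
      by (auto simp: int_marks_def)
    then show "y \<in> int_marks (uminus ` I) (uminus ` (- S))"
      unfolding eq int_marks_def by blast
  next
    fix y assume "y \<in> int_marks (uminus ` I) (uminus ` (- S))"
    then obtain n k where "n \<in> I"
      "y = of_int (- n) + (if - n \<in> uminus ` (- S) then - 1 else 1) / (real k + 3)"
      by (auto simp: int_marks_def)
    then show "y \<in> uminus ` int_marks I S"
      unfolding eq[symmetric] int_marks_def by blast
  qed
qed

lemma lim_left_int_marks: "lim_left (int_marks I S) x \<longleftrightarrow> (\<exists>n\<in>I \<inter> S. x = of_int n)"
proof
  assume "\<exists>n\<in>I \<inter> S. x = of_int n"
  then obtain n where n: "n \<in> I" "n \<in> S" "x = of_int n" by auto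
  show "lim_left (int_marks I S) x"
    unfolding lim_left_def
  proof (intro allI impI)
    fix a assume "a < x"
    then obtain k where k: "inverse (real (Suc k)) < x - a" using reals_Archimedean[of "x - a"] by auto
    have "1 / (real k + 3) < inverse (real (Suc k))" by (simp add: field_simps)
    then have "a < x - 1 / (real k + 3)" using k by simp
    moreover have "x - 1 / (real k + 3) \<in> int_marks I S"
      unfolding int_marks_def using n by (auto intro!: exI[of _ n] exI[of _ k])
    ultimately show "\<exists>b\<in>int_marks I S. a < b \<and> b < x" by (intro bexI) auto
  qed
next
  assume L: "lim_left (int_marks I S) x"
  \<comment> \<open>As \<open>1/3 + 1/3 + 1/8 < 1\<close>, all marks in the window of length
    \<open>1/8\<close> to the left of \<open>x\<close> belong to one integer
    \<open>N\<close>.\<close>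
  then obtain b0 where b0: "b0 \<in> int_marks I S" "x - 1/8 < b0" "b0 < x"
    unfolding lim_left_def by (auto dest: spec[of _ "x - 1/8"])
  obtain N where N: "N \<in> I" "\<bar>b0 - of_int N\<bar> \<le> 1/3"
  proof -
    obtain n k where "n \<in> I" "b0 = of_int n + (if n \<in> S then - 1 else 1) / (real k + 3)"
      using b0(1) by (auto simp: int_marks_def)
    moreover have "1 / (real k + 3) \<le> 1/3" by (simp add: field_simps)
    ultimately show ?thesis using that[of n] by (auto split: if_splits)
  qed
  have marks: "\<exists>k. b = of_int N + (if N \<in> S then - 1 else 1) / (real k + 3)"
    if b: "b \<in> int_marks I S" "x - 1/8 < b" "b < x" for b
  proof -
    obtain n k where n: "b = of_int n + (if n \<in> S then - 1 else 1) / (real k + 3)"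
      using b(1) by (auto simp: int_marks_def)
    have "1 / (real k + 3) \<le> 1/3" by (simp add: field_simps)
    then have "\<bar>b - of_int n\<bar> \<le> 1/3" using n by (auto split: if_splits)
    then have "\<bar>of_int n - of_int N :: real\<bar> < 1" using N(2) b b0 by linarith
    then have "n = N" by linarith
    then show ?thesis using n by blast
  qed
  have next_mark: "\<exists>k. a < of_int N + (if N \<in> S then - 1 else 1) / (real k + 3) \<and>
      of_int N + (if N \<in> S then - 1 else 1) / (real k + 3) < x" if xa: "x - 1/8 \<le> a" and ax: "a < x" for a
  proof -
    obtain b where b: "b \<in> int_marks I S" "a < b" "b < x" using L ax unfolding lim_left_def by blast
    then obtain k where "b = of_int N + (if N \<in> S then - 1 else 1) / (real k + 3)"
      using marks[of b] xa by auto
    with b show ?thesis by blast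
  qed
  show "\<exists>n\<in>I \<inter> S. x = of_int n"
  proof (cases "N \<in> S")
    case False
    \<comment> \<open>These marks decrease with \<open>k\<close>, so the least index gives the
      largest mark below \<open>x\<close> and none can follow it.\<close>
    let ?Q = "\<lambda>k. x - 1/8 < of_int N + 1 / (real k + 3) \<and> of_int N + 1 / (real k + 3) < x"
    have "\<exists>k. ?Q k" using next_mark[of "x - 1/8"] False by simp
    then obtain k where k: "?Q k" "\<And>j. j < k \<Longrightarrow> \<not> ?Q j"
      using exists_least_iff[of ?Q] by blast
    obtain j where j: "of_int N + 1 / (real k + 3) < of_int N + 1 / (real j + 3)"
      "of_int N + 1 / (real j + 3) < x"
      using next_mark[of "of_int N + 1 / (real k + 3)"] k(1) False by auto
    then have "j < k" by (simp add: divide_less_cancel field_simps)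
    then show ?thesis using k j by force
  next
    case True
    consider "x = of_int N" | "of_int N < x" | "x < of_int N" by linarith
    then show ?thesis
    proof cases
      case 1
      then show ?thesis using True N(1) by auto
    next
      case 2
      then obtain k where "max (x - 1/8) (of_int N) < of_int N - 1 / (real k + 3)"
        using next_mark[of "max (x - 1/8) (of_int N)"] True by auto
      moreover have "0 < 1 / (real k + 3)" by simp
      ultimately show ?thesis by linarith
    next
      case 3
      \<comment> \<open>Marks increasing to \<open>N\<close> leave only finitely many below
        \<open>x < N\<close>; the last of them has no successor below \<open>x\<close>.\<close>
      let ?K = "{k. x - 1/8 < of_int N - 1 / (real k + 3) \<and> of_int N - 1 / (real k + 3) < x}"
      have "?K \<subseteq> {..nat \<lceil>1 / (of_int N - x)\<rceil>}"
      proof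
        fix k assume "k \<in> ?K"
        then have "of_int N - x < 1 / (real k + 3)" by simp
        then have "real k + 3 < 1 / (of_int N - x)" using 3 by (simp add: field_simps)
        then have "real k \<le> real (nat \<lceil>1 / (of_int N - x)\<rceil>)"
          using real_nat_ceiling_ge[of "1 / (of_int N - x)"] by linarith
        then show "k \<in> {..nat \<lceil>1 / (of_int N - x)\<rceil>}" unfolding of_nat_le_iff by simp
      qed
      then have fin: "finite ?K" using finite_subset by blast
      have "?K \<noteq> {}" using next_mark[of "x - 1/8"] True by auto
      then have M: "Max ?K \<in> ?K" using fin by (rule Max_in[rotated])
      then obtain j where j: "of_int N - 1 / (real (Max ?K) + 3) < of_int N - 1 / (real j + 3)"
        "of_int N - 1 / (real j + 3) < x"
        using next_mark[of "of_int N - 1 / (real (Max ?K) + 3)"] True by auto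
      then have "Max ?K < j" by (simp add: field_simps)
      moreover have "j \<in> ?K" using j M by auto
      ultimately show ?thesis using Max_ge[OF fin, of j] by simp
    qed
  qed
qed

lemma lim_right_int_marks: "lim_right (int_marks I S) x \<longleftrightarrow> (\<exists>n\<in>I - S. x = of_int n)"
proof -
  have "lim_right (int_marks I S) x \<longleftrightarrow> (\<exists>m\<in>uminus ` I \<inter> uminus ` (- S). - x = of_int m)"
    by (simp add: lim_right_eq_lim_left uminus_int_marks lim_left_int_marks)
  also have "\<dots> \<longleftrightarrow> (\<exists>n\<in>I - S. x = of_int n)"
  proof -
    have "uminus ` I \<inter> uminus ` (- S) = uminus ` (I - S)" by auto
    then show ?thesis by simp
  qed
  finally show ?thesis .
qed

text \<open>Restricting to nonnegative integers breaks the symmetry of the line: the limit points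
  have a least element but no largest.\<close>

definition marks :: "nat set \<Rightarrow> real set" where
  "marks S = int_marks (range int) (int ` S)"

lemma countable_marks: "countable (marks S)"
proof -
  have "marks S \<subseteq> (\<lambda>(n, k). of_int n + (if n \<in> int ` S then - 1 else 1) / (real k + 3)) ` (UNIV :: (int \<times> nat) set)"
    by (force simp: marks_def int_marks_def)
  then show ?thesis by (rule countable_subset) simp
qed

lemma minus_one_notin_marks: "- 1 \<notin> marks S"
proof
  assume "- 1 \<in> marks S"
  then obtain n :: nat and k :: nat where eq: "- 1 = real n + (if int n \<in> int ` S then - 1 else 1) / (real k + 3)"
    by (auto simp: marks_def int_marks_def)
  define t where "t = 1 / (real k + 3)"
  have t: "0 < t" "t < 1" by (simp_all add: t_def field_simps)
  have "- 1 = real n - t \<or> - 1 = real n + t" using eq by (simp add: t_def split: if_splits)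
  then show False using t by linarith
qed

lemma lim_left_marks: "lim_left (marks S) x \<longleftrightarrow> (\<exists>n\<in>S. x = real n)"
proof -
  have "range int \<inter> int ` S = int ` S" by auto
  then show ?thesis by (simp add: marks_def lim_left_int_marks)
qed

lemma lim_right_marks: "lim_right (marks S) x \<longleftrightarrow> (\<exists>n. n \<notin> S \<and> x = real n)"
proof -
  have "range int - int ` S = int ` (- S)" by auto
  then show ?thesis by (simp add: marks_def lim_right_int_marks Bex_def)
qed

text \<open>Strong induction: values below \<open>n\<close> are already taken, so neither
  \<open>f n\<close> nor the preimage of \<open>n\<close> can lie below \<open>n\<close>.\<close>

lemma strict_mono_fixes_nats:
  assumes f: "strict_mono f" and N: "\<And>x. f x \<in> range real \<longleftrightarrow> x \<in> range real" and surj: "surj f"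
  shows "f (real n) = real n"
proof (induction n rule: less_induct)
  case (less n)
  obtain m where m: "f (real n) = real m" using N[of "real n"] by auto
  obtain y where y: "f y = real n" using surj by (metis surjD)
  then obtain j where j: "y = real j" using N[of y] by auto
  have "\<not> m < n"
  proof
    assume "m < n"
    then have "f (real m) = f (real n)" using less m by simp
    then show False using f \<open>m < n\<close> by (simp add: strict_mono_eq)
  qed
  moreover have "\<not> j < n" using less[of j] y j by auto
  then have "real m \<le> real n" using f y j m strict_mono_less_eq[OF f, of "real n" "real j"] by simp
  ultimately show ?case using m by simp
qed

text \<open>The value at \<open>0\<close> would be the largest natural number attained, while
  surjectivity demands its successor.\<close>

lemma strict_antimono_moves_nats:
  fixes f :: "real \<Rightarrow> real"
  assumes f: "strict_antimono_on UNIV f" and N: "\<And>x. f x \<in> range real \<longleftrightarrow> x \<in> range real" and surj: "surj f"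
  shows False
proof -
  obtain m where m: "f (real 0) = real m" using N[of "real 0"] by auto
  obtain y where y: "f y = real (Suc m)" using surj by (metis surjD)
  then have "f y \<in> range real" by (metis rangeI)
  then obtain j where j: "y = real j" using N[of y] by auto
  have "f (real j) \<le> f (real 0)"
    using f by (cases "j = 0") (auto simp: monotone_on_def less_imp_le)
  then show False using y j m by simp
qed

text \<open>A continuous bijection of the line is monotone and preserves one-sided limit points up
  to a common exchange of sides. These form the natural numbers, so the map increases and fixes each
  \<open>n\<close>; the side of approach then decides membership in \<open>S\<close> and
  \<open>T\<close>.\<close>

lemma marks_determined:
  assumes f: "continuous_on UNIV f" "bij f"
    and B: "marks S \<subseteq> B" "B \<subseteq> insert p (marks S)"
    and C: "marks T \<subseteq> f ` B" "f ` B \<subseteq> insert p (marks T)"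
  shows "S = T"
proof -
  have surj: "surj f" and inj: "inj f" using f(2) by (simp_all add: bij_def)
  have eq: "B = marks S \<or> B = insert p (marks S)" "f ` B = marks T \<or> f ` B = insert p (marks T)"
    using B C by blast+
  have LB: "lim_left B x \<longleftrightarrow> (\<exists>n\<in>S. x = real n)" and RB: "lim_right B x \<longleftrightarrow> (\<exists>n. n \<notin> S \<and> x = real n)"
    and LC: "lim_left (f ` B) x \<longleftrightarrow> (\<exists>n\<in>T. x = real n)"
    and RC: "lim_right (f ` B) x \<longleftrightarrow> (\<exists>n. n \<notin> T \<and> x = real n)" for x
    using eq by (auto simp: lim_left_insert lim_right_insert lim_left_marks lim_right_marks)
  have NB: "x \<in> range real \<longleftrightarrow> lim_left B x \<or> lim_right B x"
    and NC: "x \<in> range real \<longleftrightarrow> lim_left (f ` B) x \<or> lim_right (f ` B) x" for x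
    unfolding LB RB LC RC by auto
  consider "strict_mono f" | "strict_antimono_on UNIV f"
    using injective_eq_monotone_map[of UNIV f] f(1) inj by auto
  then show ?thesis
  proof cases
    case 1
    have "f x \<in> range real \<longleftrightarrow> x \<in> range real" for x
      using NC[of "f x"] NB[of x] lim_left_strict_mono[OF 1 surj, of B x]
        lim_right_strict_mono[OF 1 surj, of B x] by argo
    then have fix_nat: "f (real n) = real n" for n using strict_mono_fixes_nats[OF 1 _ surj] by blast
    have "n \<in> S \<longleftrightarrow> n \<in> T" for n
      using lim_left_strict_mono[OF 1 surj, of B "real n"] unfolding fix_nat LB LC by auto
    then show ?thesis by auto
  next
    case 2
    have "f x \<in> range real \<longleftrightarrow> x \<in> range real" for x
      using NC[of "f x"] NB[of x] lim_left_strict_antimono[OF 2 surj, of B x]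
        lim_right_strict_antimono[OF 2 surj, of B x] by argo
    then show ?thesis using strict_antimono_moves_nats[OF 2 _ surj] by blast
  qed
qed

section \<open>Many topologies\<close>

text \<open>The almost disjoint sets consist of the codes of the initial segments of the binary expansion of \<open>x\<close>.\<close>

definition branch :: "real \<Rightarrow> bool \<Rightarrow> nat set" where
  "branch x b = range (\<lambda>n. to_nat (n, \<lfloor>2 ^ n * x\<rfloor>, b))"

lemma infinite_branch: "infinite (branch x b)"
  unfolding branch_def by (rule range_inj_infinite) (simp add: inj_def)

text \<open>For equal reals the flags differ, so no code is shared. For different reals the floors
  differ as soon as \<open>2 ^ n * \<bar>x - y\<bar>\<close> exceeds 1.\<close>

lemma finite_branch_Int:
  assumes "(x, a) \<noteq> (y, b)" shows "finite (branch x a \<inter> branch y b)"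
proof (cases "x = y")
  case True
  then have "branch x a \<inter> branch y b = {}" using assms by (auto simp: branch_def)
  then show ?thesis by simp
next
  case False
  obtain m :: nat where "1 / \<bar>x - y\<bar> < 2 ^ m" using real_arch_pow[of 2 "1 / \<bar>x - y\<bar>"] by auto
  then have m: "1 < 2 ^ m * \<bar>x - y\<bar>" using False by (simp add: field_simps)
  have "branch x a \<inter> branch y b \<subseteq> (\<lambda>n. to_nat (n, \<lfloor>2 ^ n * x\<rfloor>, a)) ` {..<m}"
  proof
    fix k assume "k \<in> branch x a \<inter> branch y b"
    then obtain n where n: "k = to_nat (n, \<lfloor>2 ^ n * x\<rfloor>, a)" "\<lfloor>2 ^ n * x\<rfloor> = \<lfloor>2 ^ n * y\<rfloor>"
      by (auto simp: branch_def)
    have "\<bar>2 ^ n * x - 2 ^ n * y\<bar> < 1" using n(2) by linarith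
    then have "2 ^ n * \<bar>x - y\<bar> < 1" by (simp add: abs_mult flip: right_diff_distrib)
    moreover have "2 ^ m * \<bar>x - y\<bar> \<le> 2 ^ n * \<bar>x - y\<bar>" if "m \<le> n"
      using that by (intro mult_right_mono power_increasing) auto
    ultimately have "n < m" using m by (meson less_le_not_le linorder_not_le order_less_le_trans order_less_trans)
    then show "k \<in> (\<lambda>n. to_nat (n, \<lfloor>2 ^ n * x\<rfloor>, a)) ` {..<m}" using n(1) by auto
  qed
  then show ?thesis by (rule finite_subset) simp
qed

lemma branch_eq_iff: "branch x a = branch y b \<longleftrightarrow> (x, a) = (y, b)"
proof
  assume eq: "branch x a = branch y b"
  show "(x, a) = (y, b)"
  proof (rule ccontr)
    assume "(x, a) \<noteq> (y, b)"
    then have "finite (branch x a \<inter> branch y b)" by (rule finite_branch_Int)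
    then show False using infinite_branch[of x a] eq by simp
  qed
qed simp

context bumps
begin

text \<open>Membership in \<open>A\<close> is stored as the flag of each branch, so the family has
  the size of \<open>K\<close> for every \<open>A\<close> and still remembers
  \<open>A\<close>.\<close>

definition branches :: "real set \<Rightarrow> real set \<Rightarrow> nat set set" where
  "branches K A = (\<lambda>x. branch x (x \<in> A)) ` K"

lemma almost_disjoint_branches: "almost_disjoint (branches K A)"
  unfolding almost_disjoint_def
proof (intro conjI ballI impI)
  show "infinite X" if "X \<in> branches K A" for X
    using that infinite_branch by (auto simp: branches_def)
  fix X Y assume "X \<in> branches K A" "Y \<in> branches K A" and ne: "X \<noteq> Y"
  then obtain x y where "X = branch x (x \<in> A)" "Y = branch y (y \<in> A)" by (auto simp: branches_def)
  then show "finite (X \<inter> Y)" using ne by (auto intro: finite_branch_Int)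
qed

lemma branches_eqpoll: "branches K A \<approx> K"
  unfolding branches_def by (intro inj_on_image_eqpoll_self inj_onI) (simp add: branch_eq_iff)

text \<open>The two tasks are kept at separate points: the family at \<open>- 1\<close> fixes the
  weight, while the full bump sums at the marks create the non-flow points that code
  \<open>S\<close>.\<close>

definition coded_btop :: "nat set \<Rightarrow> nat set set \<Rightarrow> real topology" where
  "coded_btop S \<A> = btop (Pair (- 1) ` \<A> \<union> (\<lambda>x. (x, UNIV)) ` marks S)"

lemma fst_coded: "fst ` (Pair (- 1 :: real) ` \<A> \<union> (\<lambda>x. (x, UNIV)) ` marks S) \<subseteq> insert (- 1) (marks S)"
  by auto

lemma countable_fst_coded: "countable (fst ` (Pair (- 1 :: real) ` \<A> \<union> (\<lambda>x. (x, UNIV)) ` marks S))"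
  by (rule countable_subset[OF fst_coded]) (simp add: countable_marks)

lemma coded_fibre: "{X. (- 1, X) \<in> Pair (- 1 :: real) ` \<A> \<union> (\<lambda>x. (x, UNIV)) ` marks S} = \<A>"
  using minus_one_notin_marks by auto

lemma coded_btop_properties:
  assumes "infinite K" "almost_disjoint \<A>" "\<A> \<approx> K"
  shows "coded_btop S \<A> \<in> L_family" "completely_normal_space (coded_btop S \<A>)"
    "first_category (coded_btop S \<A>)" "has_weight (coded_btop S \<A>) K"
proof -
  let ?P = "Pair (- 1 :: real) ` \<A> \<union> (\<lambda>x. (x, UNIV)) ` marks S"
  show "coded_btop S \<A> \<in> L_family" "completely_normal_space (coded_btop S \<A>)"
    "first_category (coded_btop S \<A>)"
    unfolding coded_btop_def
    by (rule btop_in_L_family completely_normal_space_btop first_category_btop[OF countable_fst_coded])+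
  have "?P \<lesssim> K"
  proof (rule Un_lepoll_infinite[OF assms(1)])
    show "Pair (- 1 :: real) ` \<A> \<lesssim> K"
      using image_lepoll eqpoll_imp_lepoll[OF assms(3)] by (rule lepoll_trans)
    show "(\<lambda>x. (x, UNIV)) ` marks S \<lesssim> K"
      using assms(1) by (intro nat_lepoll_infinite countable_image countable_marks)
  qed
  moreover have "almost_disjoint {X. (- 1, X) \<in> ?P}" "{X. (- 1, X) \<in> ?P} \<approx> K"
    unfolding coded_fibre by (fact assms)+
  ultimately show "has_weight (coded_btop S \<A>) K"
    unfolding coded_btop_def by (rule has_weight_btop[OF assms(1)])
qed

text \<open>A homeomorphism is a Euclidean one and preserves non-flow points, which are the marks
  and possibly \<open>- 1\<close>; \<open>marks_determined\<close> then applies.\<close>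

lemma coded_btop_not_homeomorphic:
  assumes "coded_btop S \<A> homeomorphic_space coded_btop T \<B>" shows "S = T"
proof -
  obtain f g where fg: "homeomorphic_maps (coded_btop S \<A>) (coded_btop T \<B>) f g"
    using assms by (auto simp: homeomorphic_space_def)
  have top: "topspace (coded_btop S \<A>) = UNIV" for S \<A> by (simp add: coded_btop_def)
  note cont = homeomorphic_maps_btop_continuous[OF fg[unfolded coded_btop_def]]
  note inv = homeomorphic_maps_UNIV(1,2)[OF fg top top]
  define B where "B S \<A> = {x. \<not> flow_point (coded_btop S \<A>) x}" for S \<A>
  have B: "marks S \<subseteq> B S \<A>" "B S \<A> \<subseteq> insert (- 1) (marks S)" for S \<A>
  proof -
    show "marks S \<subseteq> B S \<A>"
      unfolding B_def coded_btop_def using not_flow_point_btop by auto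
    show "B S \<A> \<subseteq> insert (- 1) (marks S)"
    proof
      fix x assume "x \<in> B S \<A>"
      then have "x \<in> fst ` (Pair (- 1 :: real) ` \<A> \<union> (\<lambda>x. (x, UNIV)) ` marks S)"
        unfolding B_def coded_btop_def using flow_point_btop[OF countable_fst_coded] by blast
      then show "x \<in> insert (- 1) (marks S)" using fst_coded by blast
    qed
  qed
  have "f ` B S \<A> = B T \<B>"
  proof -
    have iff: "f x \<in> B T \<B> \<longleftrightarrow> x \<in> B S \<A>" for x
      using flow_point_homeomorphic_maps_iff[OF fg top top cont] by (simp add: B_def)
    show ?thesis
    proof (intro subset_antisym subsetI)
      show "y \<in> B T \<B>" if "y \<in> f ` B S \<A>" for y using that iff by auto
      show "y \<in> f ` B S \<A>" if "y \<in> B T \<B>" for y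
        using that iff[of "g y"] inv(2)[of y] by (metis imageI)
    qed
  qed
  moreover have "bij f" using inv by (intro o_bij[of g f]) (auto simp: o_def)
  ultimately show ?thesis
    using marks_determined[OF cont(1), of S "B S \<A>" "- 1" T] B[of S \<A>] B[of T \<B>] by simp
qed

text \<open>For \<open>x \<in> A\<close> the branch with flag \<open>True\<close> is attached to
  \<open>- 1\<close> in the first topology, hence in the second. One inclusion suffices, the
  situation being symmetric.\<close>

lemma coded_btop_inj:
  assumes "coded_btop S (branches K A) = coded_btop S (branches K A')" "A \<subseteq> K" "A' \<subseteq> K"
  shows "A \<subseteq> A'"
proof
  fix x assume x: "x \<in> A"
  have "(- 1, branch x True) \<in> Pair (- 1 :: real) ` branches K A' \<union> (\<lambda>x. (x, UNIV)) ` marks S"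
  proof (rule btop_determines_bumps[OF assms(1)[unfolded coded_btop_def]])
    show "(- 1, branch x True) \<in> Pair (- 1 :: real) ` branches K A \<union> (\<lambda>x. (x, UNIV)) ` marks S"
    proof -
      have "branch x (x \<in> A) \<in> branches K A"
        unfolding branches_def by (rule imageI) (use x assms(2) in auto)
      then show ?thesis using x by simp
    qed
    show "infinite (branch x True)" by (rule infinite_branch)
    fix Y assume "(- 1, Y) \<in> Pair (- 1 :: real) ` branches K A' \<union> (\<lambda>x. (x, UNIV)) ` marks S"
      and ne: "Y \<noteq> branch x True"
    then have "Y \<in> branches K A'" using coded_fibre[of "branches K A'" S] by blast
    then show "finite (branch x True \<inter> Y)" using ne by (auto simp: branches_def intro: finite_branch_Int)
  qed
  then have "branch x True \<in> branches K A'" using coded_fibre[of "branches K A'" S] by blast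
  then show "x \<in> A'" by (auto simp: branches_def branch_eq_iff)
qed

theorem bump_topologies:
  fixes K :: "real set"
  assumes "infinite K"
  shows "\<exists>F :: real topology set. F \<approx> Pow K \<and> F \<subseteq> L_family \<and>
           (\<forall>\<tau>\<in>F. completely_normal_space \<tau> \<and> first_category \<tau> \<and> has_weight \<tau> K) \<and>
           (\<forall>\<tau>\<in>F. \<forall>\<sigma>\<in>F. \<tau> \<noteq> \<sigma> \<longrightarrow> \<not> (\<tau> homeomorphic_space \<sigma>))"
proof -
  let ?t = "\<lambda>S A. coded_btop S (branches K A)"
  note props = coded_btop_properties[OF assms almost_disjoint_branches branches_eqpoll]
  show ?thesis
  proof (cases "Pow K \<lesssim> (UNIV :: nat set set)")
    case True
    \<comment> \<open>Only \<open>S\<close> varies here; \<open>K\<close> as second argument is just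
      one fixed choice of flags giving a family of the right size.\<close>
    let ?F = "range (\<lambda>S. ?t S K)"
    have "inj (\<lambda>S. ?t S K)"
      by (rule injI, rule coded_btop_not_homeomorphic[of _ "branches K K" _ "branches K K"]) simp
    then have "?F \<approx> (UNIV :: nat set set)" by (rule inj_on_image_eqpoll_self)
    also have "(UNIV :: nat set set) \<approx> Pow K"
    proof (rule lepoll_antisym[OF _ True])
      obtain h :: "nat \<Rightarrow> real" where "inj h" "range h \<subseteq> K"
        using assms infinite_countable_subset by blast
      then have "inj ((`) h)" "range ((`) h) \<subseteq> Pow K" by (auto simp: inj_def inj_image_eq_iff)
      then show "(UNIV :: nat set set) \<lesssim> Pow K" by (auto simp: lepoll_def)
    qed
    finally have "?F \<approx> Pow K" .
    moreover have "\<not> \<tau> homeomorphic_space \<sigma>" if "\<tau> \<in> ?F" "\<sigma> \<in> ?F" "\<tau> \<noteq> \<sigma>" for \<tau> \<sigma>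
      using that coded_btop_not_homeomorphic by blast
    ultimately show ?thesis using props by (intro exI[of _ ?F]) auto
  next
    case False
    \<comment> \<open>Now \<open>S\<close> is fixed and the flags vary, giving a family equipollent
      to \<open>Pow K\<close> whose homeomorphism classes are dominated by
      \<open>UNIV :: nat set set\<close>.\<close>
    let ?\<T> = "?t {} ` Pow K"
    have "inj_on (?t {}) (Pow K)"
    proof (rule inj_onI)
      fix A A' assume A: "A \<in> Pow K" "A' \<in> Pow K" and eq: "?t {} A = ?t {} A'"
      show "A = A'"
        using coded_btop_inj[OF eq] coded_btop_inj[OF eq[symmetric]] A by auto
    qed
    then have T: "?\<T> \<approx> Pow K" by (rule inj_on_image_eqpoll_self)
    have "equivp ((homeomorphic_space) :: real topology \<Rightarrow> real topology \<Rightarrow> bool)"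
      using homeomorphic_space_trans homeomorphic_space_sym[THEN iffD1]
      by (intro equivpI) (unfold reflp_def symp_def transp_def, blast+)
    moreover have "infinite (UNIV :: nat set set)"
      by (simp add: Finite_Set.finite_set)
    moreover have "\<not> ?\<T> \<lesssim> (UNIV :: nat set set)"
      using False lepoll_trans1[OF eqpoll_sym[OF T]] by (rule contrapos_nn)
    moreover have "{\<sigma> \<in> ?\<T>. \<sigma> homeomorphic_space \<tau>} \<lesssim> (UNIV :: nat set set)" if t: "\<tau> \<in> ?\<T>" for \<tau>
    proof -
      obtain Q where Q: "\<tau> = btop Q" using t by (auto simp: coded_btop_def)
      have "{\<sigma> \<in> ?\<T>. \<sigma> homeomorphic_space \<tau>} \<subseteq> {\<sigma> \<in> range btop. \<sigma> homeomorphic_space btop Q}"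
        by (auto simp: coded_btop_def Q)
      then show ?thesis using homeomorphic_class_lepoll by (rule lepoll_trans[OF subset_imp_lepoll])
    qed
    ultimately obtain F where F: "F \<subseteq> ?\<T>" "F \<approx> ?\<T>"
      "\<And>\<sigma> \<tau>. \<sigma> \<in> F \<Longrightarrow> \<tau> \<in> F \<Longrightarrow> \<sigma> homeomorphic_space \<tau> \<Longrightarrow> \<sigma> = \<tau>"
      by (rule transversal_eqpoll) (assumption, rule that)
    have "F \<approx> Pow K" using F(2) T by (rule eqpoll_trans)
    moreover have "F \<subseteq> L_family" "\<forall>\<tau>\<in>F. completely_normal_space \<tau> \<and> first_category \<tau> \<and> has_weight \<tau> K"
      using F(1) props by auto
    ultimately show ?thesis using F(3) by (intro exI[of _ F] conjI ballI impI) auto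
  qed
qed

end

theorem theorem11:
  fixes K :: "real set"
  assumes "infinite K"
  shows "\<exists>F :: real topology set. F \<approx> Pow K \<and> F \<subseteq> L_family \<and>
           (\<forall>\<tau>\<in>F. completely_normal_space \<tau> \<and> first_category \<tau> \<and> has_weight \<tau> K) \<and>
           (\<forall>\<tau>\<in>F. \<forall>\<sigma>\<in>F. \<tau> \<noteq> \<sigma> \<longrightarrow> \<not> (\<tau> homeomorphic_space \<sigma>))"
proof -
  obtain c r where "bumps c r" by (rule bumps_exist)
  then show ?thesis using assms by (rule bumps.bump_topologies)
qed

end
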